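(* Let $n\ge 1$, let $\xi_1<\dots<\xi_n<0<\xi_{n+1}<\dots<\xi_{2n}$ be real numbers, $\sigma=\mathrm{diag}(\xi_1,\dots,\xi_{2n})$, and consider the system $-i\,y'(x)+Q(x)y(x)=\lambda\sigma y(x)$, $x\ge 0$, where $Q$ is a measurable complex $2n\times 2n$ matrix function such that the system is $\mathcal M$-canonical and $\|Q(x)\|\le Ce^{-\varepsilon x}$ for $x\ge0$ with constants $C,\varepsilon>0$. Let $H$ be an invertible complex $n\times n$ matrix, let $S_H(\lambda)=[I+A_{H+}(\lambda)]^{-1}[I+A_{H-}(\lambda)]$ be the scattering matrix on the half-axis with the boundary condition $y_2(0,\lambda)=Hy_1(0,\lambda)$, and let $\varepsilon_0>0$ be the number defined in the context. Then the matrix functions $S_H(\lambda)$ and $S_H^{-1}(\lambda)$ are meromorphic in the strip $|\mathrm{Im}\,\lambda|<\varepsilon_0$, they have no nonreal poles, and, as $|\lambda|\to+\infty$, $$S_H(\lambda)=I+o(1),\qquad S_H^{-1}(\lambda)=I+o(1).$$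
   Context: Write $\sigma_1=\mathrm{diag}(\xi_1,\dots,\xi_n)$, $\sigma_2=\mathrm{diag}(\xi_{n+1},\dots,\xi_{2n})$, $y=\begin{bmatrix} y_1 \\ y_2 \end{bmatrix}$ with $y_1,y_2$ being $n$-dimensional, and $Q=\begin{bmatrix} q_{11} & q_{12} \\ q_{21} & q_{22} \end{bmatrix}$ with $n\times n$ blocks. $I$ is the $n\times n$ identity matrix. **$\mathcal M$-canonical.** The system is called $\mathcal M$-canonical if $q_{11}$ is strictly lower triangular ($[q_{11}]_{kj}=0$ for $j\ge k$), $q_{12}$ is lower anti-triangular ($[q_{12}]_{kj}=0$ for $k+j\le n$), $q_{21}$ is upper anti-triangular ($[q_{21}]_{kj}=0$ for $k+j\ge n+2$), and $q_{22}$ is strictly upper triangular ($[q_{22}]_{kj}=0$ for $j\le k$). **Transformation kernels.** Let $A_{ij}(x,t)$, $t\ge x\ge 0$, $i,j=1,2$, be the $n\times n$ matrix kernels with $A_{11}$ lower triangular, $A_{12}$ lower anti-triangular, $A_{21}$ upper anti-triangular, $A_{22}$ upper triangular, that form the unique bounded solution of the following system (equations for the entries allowed to be nonzero by these patterns; $[qA]_{kj}(s,\tau)$ means $[q(s)A(s,\tau)]_{kj}$; in the equations for $A_{11}$ and $A_{22}$ with $k=j$ the first, non-integral term is absent and the upper limit of integration is $+\infty$): $$[A_{11}(x,t)]_{kj}=\tfrac{i\xi_j}{\xi_j-\xi_k}[q_{11}]_{kj}\!\left(x+\tfrac{\xi_j}{\xi_j-\xi_k}(t-x)\right)+i\int_x^{x+\frac{\xi_j}{\xi_j-\xi_k}(t-x)}[q_{11}A_{11}+q_{12}A_{21}]_{kj}\!\left(s,t+\tfrac{\xi_k}{\xi_j}(s-x)\right)ds,$$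 $$[A_{21}(x,t)]_{kj}=\tfrac{i\xi_j}{\xi_j-\xi_{n+k}}[q_{21}]_{kj}\!\left(x+\tfrac{\xi_j}{\xi_j-\xi_{n+k}}(t-x)\right)+i\int_x^{x+\frac{\xi_j}{\xi_j-\xi_{n+k}}(t-x)}[q_{21}A_{11}+q_{22}A_{21}]_{kj}\!\left(s,t+\tfrac{\xi_{n+k}}{\xi_j}(s-x)\right)ds,$$ $$[A_{12}(x,t)]_{kj}=\tfrac{i\xi_{n+j}}{\xi_{n+j}-\xi_k}[q_{12}]_{kj}\!\left(x+\tfrac{\xi_{n+j}}{\xi_{n+j}-\xi_k}(t-x)\right)+i\int_x^{x+\frac{\xi_{n+j}}{\xi_{n+j}-\xi_k}(t-x)}[q_{12}A_{22}+q_{11}A_{12}]_{kj}\!\left(s,t+\tfrac{\xi_k}{\xi_{n+j}}(s-x)\right)ds,$$ $$[A_{22}(x,t)]_{kj}=\tfrac{i\xi_{n+j}}{\xi_{n+j}-\xi_{n+k}}[q_{22}]_{kj}\!\left(x+\tfrac{\xi_{n+j}}{\xi_{n+j}-\xi_{n+k}}(t-x)\right)+i\int_x^{x+\frac{\xi_{n+j}}{\xi_{n+j}-\xi_{n+k}}(t-x)}[q_{21}A_{12}+q_{22}A_{22}]_{kj}\!\left(s,t+\tfrac{\xi_{n+k}}{\xi_{n+j}}(s-x)\right)ds.$$ These kernels satisfy $\|A_{ij}(x,t)\|\le \tilde Ce^{-\varepsilon(x+\theta(t-x))}$ for $t\ge x\ge0$ with a constant $\tilde C$, where $\theta=\min\{\theta_1,\theta_2,\theta_3,\theta_4\}$,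 with indices $k,j\in\{1,\dots,n\}$, $$\theta_1=\min_{k>j}\tfrac{\xi_j}{\xi_j-\xi_k},\quad \theta_2=\min_{k+j>n}\tfrac{\xi_{n+j}}{\xi_{n+j}-\xi_k},\quad \theta_3=\min_{k+j<n+2}\tfrac{\xi_j}{\xi_j-\xi_{n+k}},\quad \theta_4=\min_{k<j}\tfrac{\xi_{n+j}}{\xi_{n+j}-\xi_{n+k}}$$ (a minimum over the empty set is $+\infty$). **Scattering matrix.** Put $A_{k1-}(\lambda)=\int_0^\infty A_{k1}(0,t)e^{i\lambda\sigma_1t}dt$, $A_{k2+}(\lambda)=\int_0^\infty A_{k2}(0,t)e^{i\lambda\sigma_2t}dt$ ($k=1,2$), and $$A_{H+}(\lambda)=A_{22+}(\lambda)-HA_{12+}(\lambda),\qquad A_{H-}(\lambda)=HA_{11-}(\lambda)H^{-1}-A_{21-}(\lambda)H^{-1}.$$ $I+A_{H-}(\lambda)$ is defined and analytic for $\mathrm{Im}\,\lambda<-\frac{\theta}{\xi_1}\varepsilon$ and $I+A_{H+}(\lambda)$ for $\mathrm{Im}\,\lambda>-\frac{\theta}{\xi_{2n}}\varepsilon$. The formula $S_H(\lambda)=[I+A_{H+}(\lambda)]^{-1}[I+A_{H-}(\lambda)]$ defines $S_H$ on $\mathbb R$ and, by the same formula, in the strip considered. **The number $\varepsilon_0$.** $\varepsilon_0=\min\{\varepsilon_1,-\frac{\theta}{\xi_1}\varepsilon,\frac{\theta}{\xi_{2n}}\varepsilon\}$, where $\varepsilon_1$ is the distance from the real axis to the set of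 nonreal zeros of the functions $\det[I+A_{H+}(\lambda)]$ and $\det[I+A_{H-}(\lambda)]$ ($\varepsilon_1=+\infty$ if there are none).
   Formalization: The asymptotics S_H = I+o(1), S_H^{-1} = I+o(1) as |λ|→∞ are asserted uniformly in each closed substrip |Im λ| ≤ δ with δ < ε_0 (in particular on the real axis), since uniformly over the whole open strip they can fail. *)

theory Defs
  imports "HOL-Complex_Analysis.Complex_Analysis"
begin

no_notation fps_nth (infixl \<open>$\<close> 75)

text \<open>
  The index set \<open>{1,\<dots>,n}\<close> is a finite linearly ordered type \<open>'n\<close>, with \<open>n = CARD('n)\<close>, and
  \<open>{1,\<dots>,2n}\<close> is \<open>'n + 'n\<close>: for \<open>k\<close> at position \<open>p\<close> in \<open>'n\<close>, \<open>Inl k\<close> stands for the index \<open>p\<close>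
  and \<open>Inr k\<close> for the index \<open>n + p\<close>.  Thus \<open>\<xi> (Inl k)\<close> and \<open>\<xi> (Inr k)\<close> are the diagonal entries
  of \<open>\<sigma>\<^sub>1\<close> and \<open>\<sigma>\<^sub>2\<close>.
\<close>

type_synonym ('a, 'n) sqmat = "(('a, 'n) vec, 'n) vec"

text \<open>The position of \<open>k\<close>, counted from 1.\<close>
definition index_pos :: "'n::{finite,linorder} \<Rightarrow> nat" where
  "index_pos k = card {..k}"

definition block11 :: "('a, 'n::finite+'n) sqmat \<Rightarrow> ('a, 'n) sqmat" where
  "block11 M = (\<chi> k j. M $ Inl k $ Inl j)"

definition block12 :: "('a, 'n::finite+'n) sqmat \<Rightarrow> ('a, 'n) sqmat" where
  "block12 M = (\<chi> k j. M $ Inl k $ Inr j)"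

definition block21 :: "('a, 'n::finite+'n) sqmat \<Rightarrow> ('a, 'n) sqmat" where
  "block21 M = (\<chi> k j. M $ Inr k $ Inl j)"

definition block22 :: "('a, 'n::finite+'n) sqmat \<Rightarrow> ('a, 'n) sqmat" where
  "block22 M = (\<chi> k j. M $ Inr k $ Inr j)"

definition diag_matrix :: "('n::finite \<Rightarrow> 'a::zero) \<Rightarrow> ('a, 'n) sqmat" where
  "diag_matrix d = (\<chi> k j. if k = j then d k else 0)"

definition lower_triangular :: "('a::zero, 'n::{finite,linorder}) sqmat \<Rightarrow> bool" where
  "lower_triangular M \<longleftrightarrow> (\<forall>k j. k < j \<longrightarrow> M $ k $ j = 0)"

definition upper_triangular :: "('a::zero, 'n::{finite,linorder}) sqmat \<Rightarrow> bool" where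
  "upper_triangular M \<longleftrightarrow> (\<forall>k j. j < k \<longrightarrow> M $ k $ j = 0)"

definition strictly_lower_triangular :: "('a::zero, 'n::{finite,linorder}) sqmat \<Rightarrow> bool" where
  "strictly_lower_triangular M \<longleftrightarrow> (\<forall>k j. k \<le> j \<longrightarrow> M $ k $ j = 0)"

definition strictly_upper_triangular :: "('a::zero, 'n::{finite,linorder}) sqmat \<Rightarrow> bool" where
  "strictly_upper_triangular M \<longleftrightarrow> (\<forall>k j. j \<le> k \<longrightarrow> M $ k $ j = 0)"

definition lower_anti_triangular :: "('a::zero, 'n::{finite,linorder}) sqmat \<Rightarrow> bool" where
  "lower_anti_triangular M \<longleftrightarrow>
     (\<forall>k j. index_pos k + index_pos j \<le> CARD('n) \<longrightarrow> M $ k $ j = 0)"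

definition upper_anti_triangular :: "('a::zero, 'n::{finite,linorder}) sqmat \<Rightarrow> bool" where
  "upper_anti_triangular M \<longleftrightarrow>
     (\<forall>k j. index_pos k + index_pos j \<ge> CARD('n) + 2 \<longrightarrow> M $ k $ j = 0)"

definition M_canonical ::
  "(real \<Rightarrow> (complex, 'n::{finite,linorder}+'n) sqmat) \<Rightarrow> bool" where
  "M_canonical Q \<longleftrightarrow> (\<forall>x\<ge>0.
     strictly_lower_triangular (block11 (Q x)) \<and>
     lower_anti_triangular (block12 (Q x)) \<and>
     upper_anti_triangular (block21 (Q x)) \<and>
     strictly_upper_triangular (block22 (Q x)))"

text \<open>
  The scalar integral equation for one kernel entry \<open>K\<close>, where \<open>a\<close> and \<open>b\<close> are the entries of
  \<open>\<sigma>\<close> belonging to its row and column, \<open>q\<close> is the corresponding entry of \<open>Q\<close>, and \<open>g s \<tau>\<close> is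
  the entry of the product of \<open>Q(s)\<close> with the kernels at \<open>(s, \<tau>)\<close>.  Lebesgue integrability is
  required explicitly because the integral of a non-integrable function is 0 in HOL.
\<close>
definition kernel_eq ::
  "real \<Rightarrow> real \<Rightarrow> (real \<Rightarrow> complex) \<Rightarrow> (real \<Rightarrow> real \<Rightarrow> complex) \<Rightarrow> (real \<Rightarrow> real \<Rightarrow> complex) \<Rightarrow> bool"
  where
  "kernel_eq a b q g K \<longleftrightarrow> (\<forall>x t. 0 \<le> x \<and> x \<le> t \<longrightarrow>
     (let u = x + b / (b - a) * (t - x) in
       set_integrable lebesgue {x..u} (\<lambda>s. g s (t + a / b * (s - x))) \<and>
       K x t = \<i> * complex_of_real (b / (b - a)) * q u
               + \<i> * (LINT s:{x..u}|lebesgue. g s (t + a / b * (s - x)))))"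

text \<open>The variant for the diagonal entries of \<open>A\<^sub>1\<^sub>1\<close> and \<open>A\<^sub>2\<^sub>2\<close>, where \<open>a = b\<close>.\<close>
definition kernel_eq_diag ::
  "(real \<Rightarrow> real \<Rightarrow> complex) \<Rightarrow> (real \<Rightarrow> real \<Rightarrow> complex) \<Rightarrow> bool" where
  "kernel_eq_diag g K \<longleftrightarrow> (\<forall>x t. 0 \<le> x \<and> x \<le> t \<longrightarrow>
     set_integrable lebesgue {x..} (\<lambda>s. g s (t + (s - x))) \<and>
     K x t = \<i> * (LINT s:{x..}|lebesgue. g s (t + (s - x))))"

text \<open>
  \<open>A x t\<close> is the block matrix of the four kernels \<open>A\<^sub>i\<^sub>j(x,t)\<close>; nothing is required outside the
  region \<open>t \<ge> x \<ge> 0\<close>.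
\<close>
definition transformation_kernels ::
  "('n::{finite,linorder}+'n \<Rightarrow> real) \<Rightarrow> (real \<Rightarrow> (complex, 'n+'n) sqmat) \<Rightarrow>
   (real \<Rightarrow> real \<Rightarrow> (complex, 'n+'n) sqmat) \<Rightarrow> bool" where
  "transformation_kernels \<xi> Q A \<longleftrightarrow>
    (let q11 = (\<lambda>s. block11 (Q s)); q12 = (\<lambda>s. block12 (Q s));
         q21 = (\<lambda>s. block21 (Q s)); q22 = (\<lambda>s. block22 (Q s));
         A11 = (\<lambda>x t. block11 (A x t)); A12 = (\<lambda>x t. block12 (A x t));
         A21 = (\<lambda>x t. block21 (A x t)); A22 = (\<lambda>x t. block22 (A x t))
     in
      (\<forall>x t. 0 \<le> x \<and> x \<le> t \<longrightarrow>
         lower_triangular (A11 x t) \<and> lower_anti_triangular (A12 x t) \<and>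
         upper_anti_triangular (A21 x t) \<and> upper_triangular (A22 x t)) \<and>
      (\<exists>M. \<forall>x t. 0 \<le> x \<and> x \<le> t \<longrightarrow> norm (A x t) \<le> M) \<and>
      (\<forall>x\<ge>0. (\<lambda>t. A x t) \<in> borel_measurable (lebesgue_on {x..})) \<and>
      (\<forall>k j. j < k \<longrightarrow>
         kernel_eq (\<xi> (Inl k)) (\<xi> (Inl j)) (\<lambda>s. q11 s $ k $ j)
           (\<lambda>s \<tau>. (q11 s ** A11 s \<tau> + q12 s ** A21 s \<tau>) $ k $ j) (\<lambda>x t. A11 x t $ k $ j)) \<and>
      (\<forall>k. kernel_eq_diag
           (\<lambda>s \<tau>. (q11 s ** A11 s \<tau> + q12 s ** A21 s \<tau>) $ k $ k) (\<lambda>x t. A11 x t $ k $ k)) \<and>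
      (\<forall>k j. index_pos k + index_pos j < CARD('n) + 2 \<longrightarrow>
         kernel_eq (\<xi> (Inr k)) (\<xi> (Inl j)) (\<lambda>s. q21 s $ k $ j)
           (\<lambda>s \<tau>. (q21 s ** A11 s \<tau> + q22 s ** A21 s \<tau>) $ k $ j) (\<lambda>x t. A21 x t $ k $ j)) \<and>
      (\<forall>k j. index_pos k + index_pos j > CARD('n) \<longrightarrow>
         kernel_eq (\<xi> (Inl k)) (\<xi> (Inr j)) (\<lambda>s. q12 s $ k $ j)
           (\<lambda>s \<tau>. (q12 s ** A22 s \<tau> + q11 s ** A12 s \<tau>) $ k $ j) (\<lambda>x t. A12 x t $ k $ j)) \<and>
      (\<forall>k j. k < j \<longrightarrow>
         kernel_eq (\<xi> (Inr k)) (\<xi> (Inr j)) (\<lambda>s. q22 s $ k $ j)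
           (\<lambda>s \<tau>. (q21 s ** A12 s \<tau> + q22 s ** A22 s \<tau>) $ k $ j) (\<lambda>x t. A22 x t $ k $ j)) \<and>
      (\<forall>k. kernel_eq_diag
           (\<lambda>s \<tau>. (q21 s ** A12 s \<tau> + q22 s ** A22 s \<tau>) $ k $ k) (\<lambda>x t. A22 x t $ k $ k)))"

text \<open>
  \<open>\<theta> = min {\<theta>\<^sub>1, \<theta>\<^sub>2, \<theta>\<^sub>3, \<theta>\<^sub>4}\<close> as one minimum over the union: an empty set (the first and the last
  one, when \<open>n = 1\<close>) contributes nothing, which is the convention that its minimum is \<open>+\<infinity>\<close>.
\<close>
definition theta :: "('n::{finite,linorder}+'n \<Rightarrow> real) \<Rightarrow> real" where
  "theta \<xi> = Min (
     {\<xi> (Inl j) / (\<xi> (Inl j) - \<xi> (Inl k)) | k j. k > j} \<union>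
     {\<xi> (Inr j) / (\<xi> (Inr j) - \<xi> (Inl k)) | k j. index_pos k + index_pos j > CARD('n)} \<union>
     {\<xi> (Inl j) / (\<xi> (Inl j) - \<xi> (Inr k)) | k j. index_pos k + index_pos j < CARD('n) + 2} \<union>
     {\<xi> (Inr j) / (\<xi> (Inr j) - \<xi> (Inr k)) | k j. k < j})"

text \<open>\<open>\<integral>\<^sub>0\<^sup>\<infinity> K(0,t) e\<^sup>i\<^sup>z\<^sup>\<sigma>\<^sup>t dt\<close> for the diagonal matrix \<open>\<sigma>\<close> with entries \<open>\<eta>\<close>.\<close>
definition kernel_transform ::
  "('n::finite \<Rightarrow> real) \<Rightarrow> (real \<Rightarrow> real \<Rightarrow> (complex, 'n) sqmat) \<Rightarrow> complex \<Rightarrow> (complex, 'n) sqmat" where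
  "kernel_transform \<eta> K z =
     (LINT t:{0..}|lebesgue. K 0 t ** diag_matrix (\<lambda>j. exp (\<i> * z * complex_of_real (\<eta> j * t))))"

definition A_H_plus ::
  "('n::{finite,linorder}+'n \<Rightarrow> real) \<Rightarrow> (complex, 'n) sqmat \<Rightarrow>
   (real \<Rightarrow> real \<Rightarrow> (complex, 'n+'n) sqmat) \<Rightarrow> complex \<Rightarrow> (complex, 'n) sqmat" where
  "A_H_plus \<xi> H A z =
     kernel_transform (\<lambda>j. \<xi> (Inr j)) (\<lambda>x t. block22 (A x t)) z
     - H ** kernel_transform (\<lambda>j. \<xi> (Inr j)) (\<lambda>x t. block12 (A x t)) z"

definition A_H_minus ::
  "('n::{finite,linorder}+'n \<Rightarrow> real) \<Rightarrow> (complex, 'n) sqmat \<Rightarrow>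
   (real \<Rightarrow> real \<Rightarrow> (complex, 'n+'n) sqmat) \<Rightarrow> complex \<Rightarrow> (complex, 'n) sqmat" where
  "A_H_minus \<xi> H A z =
     H ** kernel_transform (\<lambda>j. \<xi> (Inl j)) (\<lambda>x t. block11 (A x t)) z ** matrix_inv H
     - kernel_transform (\<lambda>j. \<xi> (Inl j)) (\<lambda>x t. block21 (A x t)) z ** matrix_inv H"

definition scattering_matrix ::
  "('n::{finite,linorder}+'n \<Rightarrow> real) \<Rightarrow> (complex, 'n) sqmat \<Rightarrow>
   (real \<Rightarrow> real \<Rightarrow> (complex, 'n+'n) sqmat) \<Rightarrow> complex \<Rightarrow> (complex, 'n) sqmat" where
  "scattering_matrix \<xi> H A z =
     matrix_inv (mat 1 + A_H_plus \<xi> H A z) ** (mat 1 + A_H_minus \<xi> H A z)"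

text \<open>
  Zeros of the two determinants are taken in the half-planes where the determinants are defined;
  outside them the transforms above need not converge.  \<open>Min UNIV\<close> and \<open>Max UNIV\<close> are the first and
  the last index, so \<open>\<xi> (Inl (Min UNIV)) = \<xi>\<^sub>1\<close> and \<open>\<xi> (Inr (Max UNIV))\<close> is the last entry of \<open>\<sigma>\<close>.
\<close>
definition nonreal_zeros ::
  "('n::{finite,linorder}+'n \<Rightarrow> real) \<Rightarrow> real \<Rightarrow> (complex, 'n) sqmat \<Rightarrow>
   (real \<Rightarrow> real \<Rightarrow> (complex, 'n+'n) sqmat) \<Rightarrow> complex set" where
  "nonreal_zeros \<xi> \<epsilon> H A =
     {z. z \<notin> \<real> \<and> Im z > - (theta \<xi> / \<xi> (Inr (Max UNIV)) * \<epsilon>)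
         \<and> det (mat 1 + A_H_plus \<xi> H A z) = 0} \<union>
     {z. z \<notin> \<real> \<and> Im z < - (theta \<xi> / \<xi> (Inl (Min UNIV)) * \<epsilon>)
         \<and> det (mat 1 + A_H_minus \<xi> H A z) = 0}"

definition eps1 ::
  "('n::{finite,linorder}+'n \<Rightarrow> real) \<Rightarrow> real \<Rightarrow> (complex, 'n) sqmat \<Rightarrow>
   (real \<Rightarrow> real \<Rightarrow> (complex, 'n+'n) sqmat) \<Rightarrow> ereal" where
  "eps1 \<xi> \<epsilon> H A =
     (if nonreal_zeros \<xi> \<epsilon> H A = {} then \<infinity> else ereal (setdist \<real> (nonreal_zeros \<xi> \<epsilon> H A)))"

definition eps0 ::
  "('n::{finite,linorder}+'n \<Rightarrow> real) \<Rightarrow> real \<Rightarrow> (complex, 'n) sqmat \<Rightarrow>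
   (real \<Rightarrow> real \<Rightarrow> (complex, 'n+'n) sqmat) \<Rightarrow> ereal" where
  "eps0 \<xi> \<epsilon> H A =
     min (eps1 \<xi> \<epsilon> H A)
       (min (ereal (- (theta \<xi> / \<xi> (Inl (Min UNIV)) * \<epsilon>)))
            (ereal (theta \<xi> / \<xi> (Inr (Max UNIV)) * \<epsilon>)))"

definition matrix_meromorphic_on :: "(complex \<Rightarrow> complex^'m^'n) \<Rightarrow> complex set \<Rightarrow> bool" where
  "matrix_meromorphic_on F S \<longleftrightarrow> (\<forall>k j. (\<lambda>z. F z $ k $ j) meromorphic_on S)"

definition matrix_pole :: "(complex \<Rightarrow> complex^'m^'n) \<Rightarrow> complex \<Rightarrow> bool" where
  "matrix_pole F z \<longleftrightarrow> (\<exists>k j. is_pole (\<lambda>w. F w $ k $ j) z)"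

end

theory Submission
  imports Defs
begin

text \<open>
  Boundedness of the kernels and the integral equations force \<open>\<bar>A(0,t)\<bar> \<le> const * e\<^sup>-\<^sup>\<epsilon>\<^sup>\<theta>\<^sup>t\<close>, by iterating
  the equations in a weighted norm for which the integral operator is a contraction.  Hence the
  matrices \<open>I + A\<^sub>H\<^sub>\<plusminus>(\<lambda>)\<close> are holomorphic in half-planes reaching beyond the real axis, and by a
  Riemann--Lebesgue lemma for one-sided Laplace transforms they tend to \<open>I\<close> as \<open>\<lambda>\<close> tends to infinity in
  a strip.  So their determinants have only finitely many zeros in a closed strip around the real
  axis, which gives \<open>\<epsilon>\<^sub>0 > 0\<close>, and Cramer's rule transfers everything to \<open>S\<^sub>H\<close> and its inverse.
\<close>

section \<open>One-sided Laplace transforms\<close>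

text \<open>The integral in each equation runs along a characteristic line: from (x,t) to the
  diagonal for the off-diagonal entries, parallel to it for the diagonal ones.
  \<open>theta \<xi>\<close> is the largest constant for which x + theta * (t - x) never decreases
  along any of these lines. A bound that decays in this quantity therefore survives the integral
  operator, and the decay of Q along the line supplies the contraction. At x = 0 the rate is
  \<epsilon> times theta; dividing it by the entry of largest modulus in each half of \<sigma> gives
  the widths that enter \<open>eps0\<close>. The limit at infinity must hold across a whole closed
  strip, not only along single lines. Multiplication by an imaginary multiple of \<xi> sends the
  strip into a half-plane, so the Riemann-Lebesgue lemma is proved with the variable free in a
  half-plane. Real zeros of the determinants are not excluded. For this reason poles are ruled out
  only off the real axis, and positivity of \<open>eps0\<close> requires that nonreal zeros do not
  approach that axis.\<close>

lemma integrable_complex_indicator: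
  assumes "B \<in> sets M" "emeasure M B < \<infinity>"
  shows "integrable M (indicator B :: 'a \<Rightarrow> complex)"
proof -
  have "(indicator B :: 'a \<Rightarrow> complex) = (\<lambda>t. complex_of_real (indicator B t))"
    by (auto simp: indicator_def)
  then show ?thesis using integrable_of_real[OF integrable_real_indicator[OF assms]] by simp
qed

text \<open>The exponent carries no minus sign, so convergence improves to the left. With c = \<i> z
  \<xi>, where \<xi> is the diagonal entry of a column, this is an entry of a kernel transform, and
  Re c = - Im z * \<xi>.\<close>

definition laplace :: "(real \<Rightarrow> complex) \<Rightarrow> complex \<Rightarrow> complex" where
  "laplace h c = (LINT t:{0..}|lebesgue. h t * exp (c * complex_of_real t))"

lemma norm_exp_mult_real_le_1:
  assumes "Re c \<le> 0" "t \<ge> 0"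
  shows "norm (exp (c * complex_of_real t)) \<le> 1"
  using assms by (simp add: mult_nonpos_nonneg)

lemma integrable_laplace:
  assumes "integrable lebesgue h" "Re c \<le> 0"
  shows "integrable lebesgue (\<lambda>t. indicator {0..} t *\<^sub>R (h t * exp (c * complex_of_real t)))"
proof (rule Bochner_Integration.integrable_bound[OF assms(1)])
  have [measurable]: "h \<in> borel_measurable lebesgue" "{0::real..} \<in> sets lebesgue"
    using assms by auto
  have [measurable]: "(\<lambda>t. exp (c * complex_of_real t)) \<in> borel_measurable lebesgue"
    by (intro measurable_completion) measurable
  show "(\<lambda>t. indicator {0..} t *\<^sub>R (h t * exp (c * complex_of_real t))) \<in> borel_measurable lebesgue"
    by measurable
  show "AE t in lebesgue. norm (indicator {0..} t *\<^sub>R (h t * exp (c * complex_of_real t))) \<le> norm (h t)"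
  proof (rule AE_I2)
    fix t :: real
    show "norm (indicator {0..} t *\<^sub>R (h t * exp (c * complex_of_real t))) \<le> norm (h t)"
      using norm_exp_mult_real_le_1[OF assms(2), of t]
      by (auto simp: indicator_def norm_mult mult_left_le)
  qed
qed

lemma laplace_add:
  assumes "integrable lebesgue g" "integrable lebesgue h" "Re c \<le> 0"
  shows "laplace (\<lambda>t. g t + h t) c = laplace g c + laplace h c"
  using integrable_laplace[OF assms(1,3)] integrable_laplace[OF assms(2,3)]
  by (simp add: laplace_def set_lebesgue_integral_def scaleR_add_right distrib_right
      flip: Bochner_Integration.integral_add)

lemma laplace_diff:
  assumes "integrable lebesgue g" "integrable lebesgue h" "Re c \<le> 0"
  shows "laplace (\<lambda>t. g t - h t) c = laplace g c - laplace h c"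
  using integrable_laplace[OF assms(1,3)] integrable_laplace[OF assms(2,3)]
  by (simp add: laplace_def set_lebesgue_integral_def scaleR_diff_right left_diff_distrib
      flip: Bochner_Integration.integral_diff)

section \<open>The Riemann-Lebesgue lemma in the closed left half-plane\<close>

lemma norm_laplace_le:
  assumes "integrable lebesgue h" "Re c \<le> 0"
  shows "norm (laplace h c) \<le> (LINT t|lebesgue. norm (h t))"
  unfolding laplace_def set_lebesgue_integral_def
proof (rule Bochner_Integration.integral_norm_bound_integral[OF integrable_laplace[OF assms]])
  show "integrable lebesgue (\<lambda>t. norm (h t))" using assms by simp
  fix t
  show "norm (indicator {0..} t *\<^sub>R (h t * exp (c * complex_of_real t))) \<le> norm (h t)"
    using norm_exp_mult_real_le_1[OF assms(2), of t]
    by (auto simp: indicator_def norm_mult mult_left_le)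
qed

text \<open>The filter lets c go to infinity in any manner inside the closed half-plane, so the
  limit is uniform in the direction. Integrability is included so that closure properties can be
  chained.\<close>

definition laplace_vanishes :: "(real \<Rightarrow> complex) \<Rightarrow> bool" where
  "laplace_vanishes h \<longleftrightarrow> integrable lebesgue h \<and>
     (laplace h \<longlongrightarrow> 0) (inf at_infinity (principal {c. Re c \<le> 0}))"

text \<open>On Re c \<le> 0 the transforms of h and g differ by at most the L1 distance of h and g,
  uniformly in c. Hence the property passes to L1 limits.\<close>

lemma laplace_vanishes_closed:
  assumes h: "integrable lebesgue h"
    and approx: "\<And>e. e > 0 \<Longrightarrow> \<exists>g. laplace_vanishes g \<and> (LINT t|lebesgue. norm (h t - g t)) < e"
  shows "laplace_vanishes h"
proof -
  have "eventually (\<lambda>c. dist (laplace h c) 0 < e) (inf at_infinity (principal {c. Re c \<le> 0}))"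
    if e: "e > 0" for e
  proof -
    obtain g where g: "integrable lebesgue g" "(LINT t|lebesgue. norm (h t - g t)) < e / 2"
      and lim: "(laplace g \<longlongrightarrow> 0) (inf at_infinity (principal {c. Re c \<le> 0}))"
      using approx[OF half_gt_zero[OF e]] unfolding laplace_vanishes_def by blast
    have "eventually (\<lambda>c. dist (laplace g c) 0 < e / 2) (inf at_infinity (principal {c. Re c \<le> 0}))"
      using lim that by (intro tendstoD) auto
    moreover have "eventually (\<lambda>c. Re c \<le> 0) (inf at_infinity (principal {c. Re c \<le> 0}))"
      by (simp add: eventually_inf_principal)
    ultimately show ?thesis
    proof eventually_elim
      case (elim c)
      have "norm (laplace h c - laplace g c) < e / 2"
        using norm_laplace_le[of "\<lambda>t. h t - g t" c] laplace_diff[OF h g(1), of c] g h elim by auto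
      moreover have "norm (laplace h c) \<le> norm (laplace h c - laplace g c) + norm (laplace g c)"
        using norm_triangle_ineq[of "laplace h c - laplace g c" "laplace g c"] by simp
      ultimately show ?case using elim by simp
    qed
  qed
  then show ?thesis using h by (auto simp: laplace_vanishes_def intro: tendstoI)
qed

lemma laplace_vanishes_add:
  assumes "laplace_vanishes g" "laplace_vanishes h"
  shows "laplace_vanishes (\<lambda>t. g t + h t)"
proof -
  have "((\<lambda>c. laplace g c + laplace h c) \<longlongrightarrow> 0 + 0) (inf at_infinity (principal {c. Re c \<le> 0}))"
    using assms by (intro tendsto_add) (auto simp: laplace_vanishes_def)
  moreover have "eventually (\<lambda>c. laplace g c + laplace h c = laplace (\<lambda>t. g t + h t) c)
      (inf at_infinity (principal {c. Re c \<le> 0}))"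
    using assms by (auto simp: eventually_inf_principal laplace_vanishes_def laplace_add)
  ultimately show ?thesis using assms
    by (auto simp: laplace_vanishes_def elim: Lim_transform_eventually)
qed

lemma laplace_vanishes_cmult:
  assumes "laplace_vanishes h"
  shows "laplace_vanishes (\<lambda>t. h t * a)"
proof -
  have "laplace (\<lambda>t. h t * a) = (\<lambda>c. laplace h c * a)"
  proof
    fix c
    have "laplace (\<lambda>t. h t * a) c =
      (LINT t|lebesgue. (indicator {0..} t *\<^sub>R (h t * exp (c * complex_of_real t))) * a)"
      unfolding laplace_def set_lebesgue_integral_def
      by (intro Bochner_Integration.integral_cong refl) (simp add: scaleR_conv_of_real mult_ac)
    then show "laplace (\<lambda>t. h t * a) c = laplace h c * a"
      by (simp only: laplace_def set_lebesgue_integral_def integral_mult_left_zero)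
  qed
  then show ?thesis using assms tendsto_mult_left_zero
    by (auto simp: laplace_vanishes_def)
qed

lemma laplace_vanishes_zero: "laplace_vanishes (\<lambda>t. 0)"
proof -
  have "laplace (\<lambda>t. 0) = (\<lambda>c. 0)"
    by (rule ext) (simp add: laplace_def set_lebesgue_integral_def)
  then show ?thesis by (simp add: laplace_vanishes_def)
qed

lemma laplace_vanishes_sum:
  assumes "finite I" "\<And>i. i \<in> I \<Longrightarrow> laplace_vanishes (g i)"
  shows "laplace_vanishes (\<lambda>t. \<Sum>i\<in>I. g i t)"
  using assms
proof (induction I rule: finite_induct)
  case empty
  then show ?case by (simp add: laplace_vanishes_zero)
next
  case (insert x F)
  then show ?case by (simp add: laplace_vanishes_add)
qed

text \<open>The transform is (exp (c b) - 1) / c, and its numerator has modulus at most 2 on Re c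
  \<le> 0. This is the only transform that is computed explicitly; all others are reached by
  approximation.\<close>

lemma laplace_vanishes_interval:
  fixes a b :: real
  assumes "0 \<le> b"
  shows "laplace_vanishes (indicator {0..b})"
proof -
  have eq: "laplace (indicator {0..b}) c = (exp (c * b) - 1) / c" if "c \<noteq> 0" for c
  proof -
    have "laplace (indicator {0..b}) c = (LINT t|lebesgue. indicator {0..b} t *\<^sub>R exp (c * complex_of_real t))"
      unfolding laplace_def set_lebesgue_integral_def
      by (intro Bochner_Integration.integral_cong refl) (auto simp: indicator_def)
    also have "\<dots> = (LINT t|lborel. indicator {0..b} t *\<^sub>R exp (c * complex_of_real t))"
      by (intro integral_completion) simp
    also have "\<dots> = exp (c * b) / c - exp (c * 0) / c"
    proof (subst integral_FTC_atLeastAtMost[where F = "\<lambda>t. exp (c * complex_of_real t) / c"])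
      show "((\<lambda>t. exp (c * complex_of_real t) / c) has_vector_derivative exp (c * complex_of_real t))
          (at t within {0..b})" for t
        using that by (auto intro!: derivative_eq_intros has_vector_derivative_real_field)
    qed (use assms in \<open>auto intro!: continuous_intros\<close>)
    finally show ?thesis by (simp add: diff_divide_distrib)
  qed
  have "((\<lambda>c. laplace (indicator {0..b}) c) \<longlongrightarrow> 0) (inf at_infinity (principal {c. Re c \<le> 0}))"
  proof (rule Lim_null_comparison)
    have "((\<lambda>c. 2 * inverse (norm c)) \<longlongrightarrow> 2 * 0) at_infinity"
      by (intro tendsto_intros tendsto_inverse_0_at_top filterlim_norm_at_top)
    then show "((\<lambda>c::complex. 2 * inverse (norm c)) \<longlongrightarrow> 0) (inf at_infinity (principal {c. Re c \<le> 0}))"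
      by (auto intro: tendsto_mono[rotated])
    have "eventually (\<lambda>c::complex. c \<noteq> 0) at_infinity"
      by (rule eventually_not_equal_at_infinity)
    then show "eventually (\<lambda>c. norm (laplace (indicator {0..b}) c) \<le> 2 * inverse (norm c))
        (inf at_infinity (principal {c. Re c \<le> 0}))"
      unfolding eventually_inf_principal
    proof eventually_elim
      case (elim c)
      show ?case
      proof
        assume c: "c \<in> {c. Re c \<le> 0}"
        have "norm (exp (c * b) - 1) \<le> norm (exp (c * b)) + norm (1::complex)" by (rule norm_triangle_ineq4)
        also have "\<dots> \<le> 2" using norm_exp_mult_real_le_1[of c b] assms c by simp
        finally show "norm (laplace (indicator {0..b}) c) \<le> 2 * inverse (norm c)"
          unfolding eq[OF elim] divide_inverse norm_mult norm_inverse by (rule mult_right_mono) simp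
      qed
    qed
  qed
  moreover have "emeasure lebesgue {0..b} = ennreal b"
    using assms by simp
  then have "integrable lebesgue (indicator {0..b} :: real \<Rightarrow> complex)"
    by (intro integrable_complex_indicator) (simp_all only: ennreal_less_top infinity_ennreal_def, simp)
  ultimately show ?thesis by (simp add: laplace_vanishes_def)
qed

text \<open>Dynkin induction from the rays \<open>{..a}\<close>. Truncation to a bounded interval
  keeps every indicator integrable, so that a complement becomes a difference from the indicator of
  \<open>{0..real N}\<close>, and that same indicator dominates the partial sums for a disjoint
  union.\<close>

lemma laplace_vanishes_borel:
  fixes B :: "real set"
  assumes "B \<in> sets borel"
  shows "laplace_vanishes (indicator (B \<inter> {0..real N}))"
proof -
  have "B \<in> sigma_sets UNIV (range (\<lambda>a. {..a::real}))"
    using assms by (subst (asm) borel_eq_atMost) simp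
  then show ?thesis
  proof (rule sigma_sets_induct_disjoint[rotated 2])
    show "Int_stable (range (\<lambda>a. {..a::real}))"
      by (auto simp: Int_stable_def)
    show "range (\<lambda>a. {..a::real}) \<subseteq> Pow UNIV" by simp
  next
    fix A assume "A \<in> range (\<lambda>a. {..a::real})"
    then obtain a where a: "A = {..a}" by auto
    show "laplace_vanishes (indicator (A \<inter> {0..real N}))"
    proof (cases "a \<ge> 0")
      case True
      then have "A \<inter> {0..real N} = {0..min a (real N)}" using a by auto
      then show ?thesis using laplace_vanishes_interval[of "min a (real N)"] True by simp
    next
      case False
      then have "A \<inter> {0..real N} = {}" using a by auto
      then show ?thesis using laplace_vanishes_zero by (simp add: indicator_def [abs_def])
    qed
  next
    show "laplace_vanishes (indicator ({} \<inter> {0..real N}))"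
      using laplace_vanishes_zero by (simp add: indicator_def [abs_def])
  next
    fix A assume "laplace_vanishes (indicator (A \<inter> {0..real N}))"
    then have "laplace_vanishes (\<lambda>t. indicator {0..real N} t + indicator (A \<inter> {0..real N}) t * (-1))"
      by (intro laplace_vanishes_add laplace_vanishes_interval laplace_vanishes_cmult) simp
    moreover have "(\<lambda>t. indicator {0..real N} t + indicator (A \<inter> {0..real N}) t * (-1)) =
      (indicator ((UNIV - A) \<inter> {0..real N}) :: real \<Rightarrow> complex)"
      by (auto simp: indicator_def fun_eq_iff)
    ultimately show "laplace_vanishes (indicator ((UNIV - A) \<inter> {0..real N}))" by simp
  next
    fix A :: "nat \<Rightarrow> real set"
    assume disj: "disjoint_family A" and rng: "range A \<subseteq> sigma_sets UNIV (range (\<lambda>a. {..a}))"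
      and P: "\<And>i. laplace_vanishes (indicator (A i \<inter> {0..real N}))"
    have [measurable]: "A i \<in> sets borel" for i
      using rng by (subst borel_eq_atMost) auto
    define s :: "nat \<Rightarrow> real \<Rightarrow> complex" where "s n = indicator ((\<Union>i<n. A i) \<inter> {0..real N})" for n
    define h :: "real \<Rightarrow> complex" where "h = indicator ((\<Union>i. A i) \<inter> {0..real N})"
    have sum: "s n = (\<lambda>t. \<Sum>i<n. indicator (A i \<inter> {0..real N}) t)" for n
    proof (induction n)
      case 0 then show ?case by (simp add: s_def fun_eq_iff)
    next
      case (Suc n)
      have "t \<notin> A i" if "t \<in> A n" "i < n" for i t
        using disjoint_family_onD[OF disj, of i n] that by auto
      then have "s (Suc n) t = s n t + indicator (A n \<inter> {0..real N}) t" for t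
        unfolding s_def lessThan_Suc by (cases "t \<in> A n") (auto simp: indicator_def)
      then show ?case by (auto simp: Suc fun_eq_iff)
    qed
    have vs: "laplace_vanishes (s n)" for n
      unfolding sum by (intro laplace_vanishes_sum P) auto
    have bnd: "integrable lebesgue (indicator {0..real N} :: real \<Rightarrow> real)"
      by (simp add: integrable_completion)
    have conv: "(\<lambda>n. s n t) \<longlonglongrightarrow> h t" for t
    proof (cases "t \<in> (\<Union>i. A i)")
      case True
      then obtain i where "t \<in> A i" by auto
      have "s n t = h t" if "i < n" for n
      proof -
        have "t \<in> (\<Union>i<n. A i)" "t \<in> (\<Union>i. A i)" using \<open>t \<in> A i\<close> that by blast+
        then show ?thesis unfolding s_def h_def indicator_def by simp
      qed
      then have "eventually (\<lambda>n. s n t = h t) sequentially"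
        by (auto simp: eventually_sequentially intro: exI[of _ "Suc i"])
      then show ?thesis by (rule tendsto_eventually)
    qed (auto simp: s_def h_def)
    have meas: "s n \<in> borel_measurable lebesgue" "h \<in> borel_measurable lebesgue" for n
      unfolding s_def h_def by (rule measurable_completion, measurable)+
    have "integrable lebesgue h"
      by (rule Bochner_Integration.integrable_bound[OF bnd meas(2)]) (simp add: h_def indicator_def)
    moreover have "\<exists>g. laplace_vanishes g \<and> (LINT t|lebesgue. norm (h t - g t)) < e" if "e > 0" for e
    proof -
      have "(\<lambda>n. LINT t|lebesgue. norm (h t - s n t)) \<longlonglongrightarrow> (LINT t|lebesgue. norm (h t - h t))"
      proof (rule integral_dominated_convergence[OF _ _ bnd])
        show "AE t in lebesgue. (\<lambda>n. norm (h t - s n t)) \<longlonglongrightarrow> norm (h t - h t)"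
          by (intro AE_I2 tendsto_norm tendsto_diff tendsto_const conv)
        show "AE t in lebesgue. norm (norm (h t - s n t)) \<le> indicator {0..real N} t" for n
        proof (rule AE_I2)
          fix t
          have "(\<Union>i<n. A i) \<subseteq> (\<Union>i. A i)" by blast
          then show "norm (norm (h t - s n t)) \<le> indicator {0..real N} t"
            unfolding h_def s_def by (simp add: indicator_def subset_iff)
        qed
        have [measurable]: "s n \<in> borel_measurable lebesgue" "h \<in> borel_measurable lebesgue" for n
          by (rule meas)+
        show "(\<lambda>t. norm (h t - h t)) \<in> borel_measurable lebesgue"
          "(\<lambda>t. norm (h t - s n t)) \<in> borel_measurable lebesgue" for n
          by measurable
      qed
      then have "eventually (\<lambda>n. (LINT t|lebesgue. norm (h t - s n t)) < e) sequentially"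
        using that by (intro order_tendstoD) auto
      then show ?thesis using vs eventually_happens'[OF sequentially_bot] by blast
    qed
    ultimately have "laplace_vanishes h" by (rule laplace_vanishes_closed)
    then show "laplace_vanishes (indicator (\<Union> (range A) \<inter> {0..real N}))" by (simp add: h_def)
  qed
qed

text \<open>The transform sees only t \<ge> 0 and ignores null sets. This serves to pass from Borel
  to Lebesgue sets and to discard the negative half-line.\<close>

lemma laplace_vanishes_cong_AE:
  assumes "laplace_vanishes g" "AE t in lebesgue. t \<ge> 0 \<longrightarrow> g t = h t" "integrable lebesgue h"
  shows "laplace_vanishes h"
proof -
  have m: "(\<lambda>t. indicator {0..} t *\<^sub>R (f t * exp (c * complex_of_real t))) \<in> borel_measurable lebesgue"
    if "integrable lebesgue f" for c f
  proof -
    have [measurable]: "f \<in> borel_measurable lebesgue" "{0::real..} \<in> sets lebesgue"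
      using that by auto
    have [measurable]: "(\<lambda>t. exp (c * complex_of_real t)) \<in> borel_measurable lebesgue"
      by (intro measurable_completion) measurable
    show ?thesis by measurable
  qed
  have "laplace g = laplace h"
    unfolding laplace_def set_lebesgue_integral_def
    using assms m by (intro ext integral_cong_AE) (auto simp: laplace_vanishes_def indicator_def)
  then show ?thesis using assms by (simp add: laplace_vanishes_def)
qed

text \<open>Integrable functions are generated by indicators of sets of finite measure under sums
  and dominated limits. Sums are immediate, and a dominated limit is an L1 limit, so only the
  indicators need work.\<close>

lemma riemann_lebesgue_laplace:
  assumes "integrable lebesgue h"
  shows "laplace_vanishes h"
  using assms
proof (induction rule: integrable_induct)
  case (base A a)
  \<comment> \<open>A Lebesgue set is a Borel set up to a null set, and only the Borel part S is
    accessible to the Dynkin argument.\<close>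
  then obtain S N N' where S: "A = S \<union> N" "N \<subseteq> N'" "N' \<in> null_sets lborel" "S \<in> sets lborel"
    by (auto elim: sets_completionE)
  have [measurable]: "A \<in> sets lebesgue" using base by simp
  have fin: "emeasure lebesgue B < \<infinity>" if "B \<in> sets lebesgue" "B \<subseteq> A" for B
  proof -
    have "emeasure lebesgue B \<le> emeasure lebesgue A" using that base by (intro emeasure_mono) auto
    then show "emeasure lebesgue B < \<infinity>" using base(2) by (rule order.strict_trans1)
  qed
  have intA: "integrable lebesgue (indicator B :: real \<Rightarrow> real)"
    and intAc: "integrable lebesgue (indicator B :: real \<Rightarrow> complex)"
    if "B \<in> sets lebesgue" "B \<subseteq> A" for B
    using fin[OF that] that by (auto intro: integrable_complex_indicator integrable_real_indicator)
  have AN: "laplace_vanishes (indicator (A \<inter> {0..real n}))" for n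
  proof (rule laplace_vanishes_cong_AE)
    show "laplace_vanishes (indicator (S \<inter> {0..real n}))"
      using S by (intro laplace_vanishes_borel) auto
    have "AE t in lebesgue. t \<notin> N'"
      using S by (intro AE_completion AE_not_in)
    then show "AE t in lebesgue. t \<ge> 0 \<longrightarrow> indicator (S \<inter> {0..real n}) t = (indicator (A \<inter> {0..real n}) t :: complex)"
      by eventually_elim (use S in \<open>auto simp: indicator_def\<close>)
  qed (auto intro!: intAc)
  \<comment> \<open>A set of finite measure may be unbounded; its truncations converge to it in L1,
    dominated by the indicator of A.\<close>
  have "laplace_vanishes (indicator (A \<inter> {0..}))"
  proof (rule laplace_vanishes_closed)
    fix e :: real assume "e > 0"
    have "(\<lambda>n. LINT t|lebesgue. norm (indicator (A \<inter> {0..}) t - indicator (A \<inter> {0..real n}) t :: complex))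
       \<longlonglongrightarrow> (LINT t|(lebesgue::real measure). 0::real)"
    proof (rule integral_dominated_convergence[where w = "indicator A"])
      show "AE t in lebesgue. (\<lambda>n. norm (indicator (A \<inter> {0..}) t - indicator (A \<inter> {0..real n}) t :: complex)) \<longlonglongrightarrow> 0"
      proof (rule AE_I2)
        fix t :: real
        obtain m where m: "t \<le> real m" using real_arch_simple by blast
        have "eventually (\<lambda>n. norm (indicator (A \<inter> {0..}) t - indicator (A \<inter> {0..real n}) t :: complex) = 0) sequentially"
          using eventually_ge_at_top[of m]
          by eventually_elim (use m in \<open>auto simp: indicator_def\<close>)
        then show "(\<lambda>n. norm (indicator (A \<inter> {0..}) t - indicator (A \<inter> {0..real n}) t :: complex)) \<longlonglongrightarrow> 0"
          by (rule tendsto_eventually)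
      qed
      show "AE t in lebesgue. norm (norm (indicator (A \<inter> {0..}) t - indicator (A \<inter> {0..real n}) t :: complex)) \<le> indicator A t" for n
        by (rule AE_I2) (auto simp: indicator_def)
      have [measurable]: "A \<inter> {0..} \<in> sets lebesgue" "A \<inter> {0..real n} \<in> sets lebesgue" for n
        by auto
      show "(\<lambda>t. norm (indicator (A \<inter> {0..}) t - indicator (A \<inter> {0..real n}) t :: complex)) \<in> borel_measurable lebesgue" for n
        by measurable
    qed (auto intro!: intA)
    then have "eventually (\<lambda>n. (LINT t|lebesgue. norm (indicator (A \<inter> {0..}) t - indicator (A \<inter> {0..real n}) t :: complex)) < e) sequentially"
      using \<open>e > 0\<close> by (intro order_tendstoD) auto
    then show "\<exists>g. laplace_vanishes g \<and> (LINT t|lebesgue. norm (indicator (A \<inter> {0..}) t - g t)) < e"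
      using AN eventually_happens'[OF sequentially_bot] by blast
  qed (auto intro!: intAc)
  then have "laplace_vanishes (indicator A)"
    by (rule laplace_vanishes_cong_AE) (auto intro!: intAc simp: indicator_def)
  then show ?case
    using laplace_vanishes_cmult[where h = "indicator A" and a = a] by (simp add: scaleR_conv_of_real of_real_indicator)
next
  case (add f g)
  then show ?case by (intro laplace_vanishes_add)
next
  case (lim f s)
  have P: "laplace_vanishes (s i)" and int: "integrable lebesgue (s i)" "integrable lebesgue f"
    and conv: "(\<lambda>i. s i t) \<longlonglongrightarrow> f t" and bnd: "norm (s i t) \<le> 2 * norm (f t)" for i t
    using lim by simp_all
  show ?case
  proof (rule laplace_vanishes_closed)
    fix e :: real assume "e > 0"
    have [measurable]: "f \<in> borel_measurable lebesgue" "s i \<in> borel_measurable lebesgue" for i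
      using int by auto
    have "(\<lambda>i. LINT t|lebesgue. norm (f t - s i t)) \<longlonglongrightarrow> (LINT t|lebesgue. norm (f t - f t))"
    \<comment> \<open>The 3 is 1 + 2: one multiple of the norm of f for f itself, two for its
      approximants.\<close>
    proof (rule integral_dominated_convergence[where w = "\<lambda>t. 3 * norm (f t)"])
      show "AE t in lebesgue. (\<lambda>i. norm (f t - s i t)) \<longlonglongrightarrow> norm (f t - f t)"
        by (intro AE_I2 tendsto_norm tendsto_diff tendsto_const conv)
      show "AE t in lebesgue. norm (norm (f t - s i t)) \<le> 3 * norm (f t)" for i
      proof (rule AE_I2)
        fix t
        have "norm (f t - s i t) \<le> norm (f t) + norm (s i t)" by (rule norm_triangle_ineq4)
        then show "norm (norm (f t - s i t)) \<le> 3 * norm (f t)" using bnd[of i t] by simp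
      qed
      show "integrable lebesgue (\<lambda>t. 3 * norm (f t))" using int by simp
    qed measurable
    then have "eventually (\<lambda>n. (LINT t|lebesgue. norm (f t - s n t)) < e) sequentially"
      using \<open>e > 0\<close> by (intro order_tendstoD) auto
    then show "\<exists>g. laplace_vanishes g \<and> (LINT t|lebesgue. norm (f t - g t)) < e"
      using P eventually_happens'[OF sequentially_bot] by blast
  qed fact
qed

section \<open>Transforms of exponentially decaying functions beyond the imaginary axis\<close>

lemma integrable_exp_decay:
  fixes k :: real
  assumes "k > 0"
  shows "integrable lebesgue (\<lambda>t. indicator {0..} t * exp (- k * t))"
proof -
  have "(\<integral>\<^sup>+x. ennreal (exp (- k * x)) * indicator {0..} x \<partial>lborel) = 0 - (- exp (- k * 0) / k)"
  proof (rule nn_integral_FTC_atLeast)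
    show "((\<lambda>x. - exp (- k * x) / k) \<longlongrightarrow> 0) at_top"
      using assms by real_asymp
  qed (use assms in \<open>auto intro!: derivative_eq_intros\<close>)
  then have "(\<integral>\<^sup>+x. ennreal (indicator {0..} x * exp (- k * x)) \<partial>lborel) < \<infinity>"
    by (simp add: indicator_mult_ennreal mult.commute)
  then have "integrable lborel (\<lambda>t. indicator {0..} t * exp (- k * t))"
    by (intro integrableI_nonneg) auto
  then show ?thesis by (simp add: integrable_completion)
qed

text \<open>Everything is demanded on t \<ge> 0 only, because the kernels are constrained only for t
  \<ge> x \<ge> 0. Measurability on the whole line is recovered by multiplying with the indicator of
  \<open>{0..}\<close>.\<close>

locale exp_decaying =
  fixes h :: "real \<Rightarrow> complex" and B \<kappa> :: real
  assumes meas: "h \<in> borel_measurable (lebesgue_on {0..})"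
    and bound: "\<And>t. t \<ge> 0 \<Longrightarrow> norm (h t) \<le> B * exp (- \<kappa> * t)"
begin

lemma meas_mult:
  assumes g: "g \<in> borel_measurable borel"
  shows "(\<lambda>t. indicator {0..} t *\<^sub>R (h t * g t)) \<in> borel_measurable lebesgue"
proof -
  have [measurable]: "(\<lambda>t. indicator {0..} t *\<^sub>R h t) \<in> borel_measurable lebesgue"
    using meas by (simp add: borel_measurable_restrict_space_iff)
  have [measurable]: "g \<in> borel_measurable lebesgue"
    using g by (intro measurable_completion) simp
  have "(\<lambda>t. (indicator {0..} t *\<^sub>R h t) * g t) \<in> borel_measurable lebesgue" by measurable
  then show ?thesis by simp
qed

text \<open>Growth of g at a rate below \<kappa> is absorbed by the decay of h. The lemma covers
  both the transform itself and the dominating function for its difference quotients.\<close>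

lemma integrable_mult:
  assumes g: "g \<in> borel_measurable borel"
    and g_le: "\<And>t. t \<ge> 0 \<Longrightarrow> norm (g t) \<le> D * exp (a * t)" and "a < \<kappa>"
  shows "integrable lebesgue (\<lambda>t. indicator {0..} t *\<^sub>R (h t * g t))"
proof (rule Bochner_Integration.integrable_bound)
  show "integrable lebesgue (\<lambda>t. B * D * (indicator {0..} t * exp (- (\<kappa> - a) * t)))"
    using assms by (intro integrable_mult_right integrable_exp_decay) simp
  show "(\<lambda>t. indicator {0..} t *\<^sub>R (h t * g t)) \<in> borel_measurable lebesgue"
    by (rule meas_mult[OF g])
  show "AE t in lebesgue. norm (indicator {0..} t *\<^sub>R (h t * g t)) \<le>
      norm (B * D * (indicator {0..} t * exp (- (\<kappa> - a) * t)))"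
  proof (rule AE_I2)
    fix t :: real
    show "norm (indicator {0..} t *\<^sub>R (h t * g t)) \<le> norm (B * D * (indicator {0..} t * exp (- (\<kappa> - a) * t)))"
    proof (cases "t \<ge> 0")
      case True
      have "norm (h t) * norm (g t) \<le> (B * exp (- \<kappa> * t)) * (D * exp (a * t))"
        using bound[OF True] g_le[OF True] by (intro mult_mono) (auto intro: order_trans[OF norm_ge_zero])
      also have "\<dots> = B * D * exp (- (\<kappa> - a) * t)"
        by (simp add: algebra_simps flip: exp_add)
      also have "\<dots> \<le> norm (B * D * exp (- (\<kappa> - a) * t))" by simp
      finally show ?thesis using True by (simp add: norm_mult)
    qed simp
  qed
qed

lemma integrable_transform:
  assumes "Re c < \<kappa>"
  shows "integrable lebesgue (\<lambda>t. indicator {0..} t *\<^sub>R (h t * exp (c * complex_of_real t)))"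
  using assms by (intro integrable_mult[where D = 1 and a = "Re c"]) auto

text \<open>Shifting c by \<kappa>' amounts to multiplying h by exp (\<kappa>' t). The product is
  still integrable as \<kappa>' < \<kappa>, so the half-plane Re c \<le> 0 suffices.\<close>

lemma laplace_tendsto_0:
  assumes "\<kappa>' < \<kappa>"
  shows "(laplace h \<longlongrightarrow> 0) (inf at_infinity (principal {c. Re c \<le> \<kappa>'}))"
proof -
  define g where "g = (\<lambda>t. indicator {0..} t *\<^sub>R (h t * exp (complex_of_real \<kappa>' * complex_of_real t)))"
  have "integrable lebesgue g"
    unfolding g_def using assms by (intro integrable_transform) simp
  then have "(laplace g \<longlongrightarrow> 0) (inf at_infinity (principal {c. Re c \<le> 0}))"
    using riemann_lebesgue_laplace laplace_vanishes_def by blast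
  moreover have "filterlim (\<lambda>c. c - complex_of_real \<kappa>') (inf at_infinity (principal {c. Re c \<le> 0}))
      (inf at_infinity (principal {c. Re c \<le> \<kappa>'}))"
  proof (rule filterlim_inf[THEN iffD2], intro conjI)
    have "filterlim (\<lambda>c. c + - complex_of_real \<kappa>') at_infinity at_infinity"
      by (rule tendsto_add_filterlim_at_infinity') (auto intro: filterlim_ident)
    then show "filterlim (\<lambda>c. c - complex_of_real \<kappa>') at_infinity (inf at_infinity (principal {c. Re c \<le> \<kappa>'}))"
      by (auto intro: filterlim_mono)
    show "filterlim (\<lambda>c. c - complex_of_real \<kappa>') (principal {c. Re c \<le> 0}) (inf at_infinity (principal {c. Re c \<le> \<kappa>'}))"
      by (simp add: filterlim_principal eventually_inf_principal)
  qed
  ultimately have "((\<lambda>c. laplace g (c - complex_of_real \<kappa>')) \<longlongrightarrow> 0) (inf at_infinity (principal {c. Re c \<le> \<kappa>'}))"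
    by (rule filterlim_compose)
  moreover have "laplace g (c - complex_of_real \<kappa>') = laplace h c" for c
    unfolding laplace_def set_lebesgue_integral_def g_def
    by (intro Bochner_Integration.integral_cong refl)
       (auto simp: indicator_def algebra_simps simp flip: exp_add)
  ultimately show ?thesis by simp
qed

text \<open>Differentiation under the integral sign: the difference quotients of the exponential are
  dominated, and dominated convergence is applied along an arbitrary sequence tending to c.\<close>

lemma laplace_has_field_derivative:
  assumes "Re c < \<kappa>"
  shows "(laplace h has_field_derivative laplace (\<lambda>t. complex_of_real t * h t) c) (at c)"
proof -
  \<comment> \<open>Half of the gap to \<kappa> goes to the radius of the ball around c; a further
    quarter absorbs the factor t from the derivative, leaving the rate Re c + r + r / 2 below
    \<kappa>.\<close>
  define r where "r = (\<kappa> - Re c) / 2"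
  have r: "r > 0" using assms by (simp add: r_def)
  have Re_le: "Re w \<le> Re c + r" if "w \<in> ball c r" for w
  proof -
    have "norm (w - c) < r" using that by (simp add: dist_norm norm_minus_commute)
    then show ?thesis using abs_Re_le_cmod[of "w - c"] by simp
  qed
  define q where "q = (\<lambda>w t. (exp (w * complex_of_real t) - exp (c * complex_of_real t)) / (w - c))"
  have q_le: "norm (q w t) \<le> t * exp ((Re c + r) * t)" if "w \<in> ball c r" "w \<noteq> c" "t \<ge> 0" for w t
  proof -
    have "norm (exp (w * complex_of_real t) - exp (c * complex_of_real t)) \<le> (t * exp ((Re c + r) * t)) * norm (w - c)"
    proof (rule field_differentiable_bound[of "ball c r" "\<lambda>w. exp (w * complex_of_real t)" "\<lambda>w. exp (w * complex_of_real t) * complex_of_real t"])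
      fix z assume z: "z \<in> ball c r"
      show "norm (exp (z * complex_of_real t) * complex_of_real t) \<le> t * exp ((Re c + r) * t)"
        using that Re_le[OF z] by (simp add: norm_mult mult.commute mult_left_mono)
    qed (use that r in \<open>auto intro!: derivative_eq_intros\<close>)
    then show ?thesis using that by (simp add: q_def norm_divide divide_le_eq)
  qed
  have t_le: "t \<le> 2 / r * exp (r / 2 * t)" if "t \<ge> 0" for t
    using exp_ge_add_one_self[of "r / 2 * t"] r by (simp add: field_simps)
  have q_le': "norm (q w t) \<le> 2 / r * exp ((Re c + r + r / 2) * t)" if "w \<in> ball c r" "w \<noteq> c" "t \<ge> 0" for w t
  proof -
    have "norm (q w t) \<le> (2 / r * exp (r / 2 * t)) * exp ((Re c + r) * t)"
      using q_le[OF that] t_le[OF that(3)] by (elim order_trans) (intro mult_right_mono, auto)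
    also have "\<dots> = 2 / r * exp ((Re c + r + r / 2) * t)"
      by (simp add: algebra_simps flip: exp_add)
    finally show ?thesis .
  qed
  have small: "Re c + r + r / 2 < \<kappa>" using r by (simp add: r_def field_simps)
  have "((\<lambda>w. (laplace h w - laplace h c) / (w - c)) \<longlongrightarrow> laplace (\<lambda>t. complex_of_real t * h t) c) (at c within ball c r)"
    unfolding tendsto_at_iff_sequentially
  proof (intro allI impI)
    fix X :: "nat \<Rightarrow> complex" assume X: "\<forall>i. X i \<in> ball c r - {c}" "X \<longlonglongrightarrow> c"
    have Xat: "filterlim X (at c) sequentially"
      using X by (auto simp: filterlim_at)
    have "(\<lambda>i. LINT t|lebesgue. indicator {0..} t *\<^sub>R (h t * q (X i) t)) \<longlonglongrightarrow>
       (LINT t|lebesgue. indicator {0..} t *\<^sub>R (h t * (complex_of_real t * exp (c * complex_of_real t))))"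
    proof (rule integral_dominated_convergence)
      show "integrable lebesgue (\<lambda>t. norm (indicator {0..} t *\<^sub>R (h t * complex_of_real (2 / r * exp ((Re c + r + r / 2) * t)))))"
        using small r by (intro integrable_norm integrable_mult[where D = "2 / r" and a = "Re c + r + r / 2"]) (auto simp: norm_mult norm_divide)
      show "AE t in lebesgue. (\<lambda>i. indicator {0..} t *\<^sub>R (h t * q (X i) t)) \<longlonglongrightarrow>
         indicator {0..} t *\<^sub>R (h t * (complex_of_real t * exp (c * complex_of_real t)))"
      proof (intro AE_I2 tendsto_scaleR tendsto_mult tendsto_const)
        fix t :: real
        have "((\<lambda>w. exp (w * complex_of_real t)) has_field_derivative complex_of_real t * exp (c * complex_of_real t)) (at c)"
          by (auto intro!: derivative_eq_intros)
        then have "((\<lambda>w. q w t) \<longlongrightarrow> complex_of_real t * exp (c * complex_of_real t)) (at c)"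
          by (simp add: has_field_derivative_iff q_def)
        then show "(\<lambda>i. q (X i) t) \<longlonglongrightarrow> complex_of_real t * exp (c * complex_of_real t)"
          by (rule filterlim_compose[OF _ Xat])
      qed
      show "AE t in lebesgue. norm (indicator {0..} t *\<^sub>R (h t * q (X i) t)) \<le>
          norm (indicator {0..} t *\<^sub>R (h t * complex_of_real (2 / r * exp ((Re c + r + r / 2) * t))))" for i
      proof (rule AE_I2)
        fix t :: real
        show "norm (indicator {0..} t *\<^sub>R (h t * q (X i) t)) \<le>
          norm (indicator {0..} t *\<^sub>R (h t * complex_of_real (2 / r * exp ((Re c + r + r / 2) * t))))"
        proof (cases "t \<ge> 0")
          case True
          have "norm (h t) * norm (q (X i) t) \<le> norm (h t) * (2 / r * exp ((Re c + r + r / 2) * t))"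
            using q_le'[of "X i" t] X True by (intro mult_left_mono) auto
          then show ?thesis using True r by (simp add: norm_mult norm_divide)
        qed simp
      qed
      show "(\<lambda>t. indicator {0..} t *\<^sub>R (h t * (complex_of_real t * exp (c * complex_of_real t)))) \<in> borel_measurable lebesgue"
        "(\<lambda>t. indicator {0..} t *\<^sub>R (h t * q (X i) t)) \<in> borel_measurable lebesgue" for i
        unfolding q_def by (intro meas_mult; measurable)+
    qed
    moreover have "(LINT t|lebesgue. indicator {0..} t *\<^sub>R (h t * q (X i) t)) = (laplace h (X i) - laplace h c) / (X i - c)" for i
    proof -
      have "X i \<in> ball c r" using X(1) by blast
      then have "Re (X i) < \<kappa>" using Re_le[of "X i"] small r by linarith
      note * = integrable_transform[OF this] integrable_transform[OF assms]
      have "(laplace h (X i) - laplace h c) / (X i - c) =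
        (LINT t|lebesgue. (indicator {0..} t *\<^sub>R (h t * exp (X i * complex_of_real t)) - indicator {0..} t *\<^sub>R (h t * exp (c * complex_of_real t))) / (X i - c))"
        by (simp only: laplace_def set_lebesgue_integral_def integral_divide_zero Bochner_Integration.integral_diff[OF *])
      also have "\<dots> = (LINT t|lebesgue. indicator {0..} t *\<^sub>R (h t * q (X i) t))"
        by (intro Bochner_Integration.integral_cong refl) (simp add: q_def indicator_def diff_divide_distrib right_diff_distrib)
      finally show ?thesis by simp
    qed
    moreover have "(LINT t|lebesgue. indicator {0..} t *\<^sub>R (h t * (complex_of_real t * exp (c * complex_of_real t)))) = laplace (\<lambda>t. complex_of_real t * h t) c"
      by (simp add: laplace_def set_lebesgue_integral_def mult_ac)
    ultimately show "((\<lambda>w. (laplace h w - laplace h c) / (w - c)) \<circ> X) \<longlonglongrightarrow> laplace (\<lambda>t. complex_of_real t * h t) c"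
      by (simp add: comp_def)
  qed
  moreover have "at c within ball c r = at c"
    using r by (intro at_within_open) auto
  ultimately show ?thesis by (simp only: has_field_derivative_iff)
qed

lemma holomorphic_laplace: "laplace h holomorphic_on {c. Re c < \<kappa>}"
  unfolding holomorphic_on_def field_differentiable_def
  by (blast intro: has_field_derivative_at_within laplace_has_field_derivative)

end

section \<open>Exponential decay of the transformation kernels\<close>

text \<open>The integrand is the derivative of - exp (2 p exp (- k s)) / 2. The factor 2 in the
  exponent is what yields the final division by 2, that is, the contraction constant 1/2.\<close>

lemma has_bochner_integral_weight:
  fixes p k x :: real
  assumes "p \<ge> 0" "k > 0"
  shows "has_bochner_integral lebesgue
    (\<lambda>s. indicator {x..} s * (p * k * exp (- k * s) * exp (2 * p * exp (- k * s))))
    ((exp (2 * p * exp (- k * x)) - 1) / 2)"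
proof -
  have "(\<integral>\<^sup>+s. ennreal (p * k * exp (- k * s) * exp (2 * p * exp (- k * s))) * indicator {x..} s \<partial>lborel)
      = (- 1 / 2) - (- exp (2 * p * exp (- k * x)) / 2)"
  proof (rule nn_integral_FTC_atLeast)
    have "((\<lambda>s. exp (- k * s)) \<longlongrightarrow> 0) at_top"
      using assms by real_asymp
    then have "((\<lambda>s. - exp (2 * p * exp (- k * s)) / 2) \<longlongrightarrow> - exp (2 * p * 0) / 2) at_top"
      by (intro tendsto_intros) auto
    then show "((\<lambda>s. - exp (2 * p * exp (- k * s)) / 2) \<longlongrightarrow> - 1 / 2) at_top" by simp
  qed (use assms in \<open>auto intro!: derivative_eq_intros\<close>)
  then have "(\<integral>\<^sup>+s. ennreal (indicator {x..} s * (p * k * exp (- k * s) * exp (2 * p * exp (- k * s)))) \<partial>lborel)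
      = ennreal ((exp (2 * p * exp (- k * x)) - 1) / 2)"
    by (simp add: indicator_mult_ennreal mult.commute diff_divide_distrib)
  then have "has_bochner_integral lborel
    (\<lambda>s. indicator {x..} s * (p * k * exp (- k * s) * exp (2 * p * exp (- k * s))))
    ((exp (2 * p * exp (- k * x)) - 1) / 2)"
    using assms by (intro has_bochner_integral_nn_integral) auto
  then show ?thesis
    by (auto simp: has_bochner_integral_iff integrable_completion integral_completion)
qed

text \<open>An arbitrary S inside \<open>{x..}\<close> allows one estimate for both ranges of
  integration, the bounded interval up to the diagonal and the whole half-line.\<close>

lemma norm_set_integral_le_weight:
  fixes f :: "real \<Rightarrow> complex"
  assumes "p \<ge> 0" "k > 0" "c \<ge> 0" "S \<subseteq> {x..}"
    and int: "set_integrable lebesgue S f"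
    and le: "\<And>s. s \<in> S \<Longrightarrow> norm (f s) \<le> c * (p * k * exp (- k * s) * exp (2 * p * exp (- k * s)))"
  shows "norm (LINT s:S|lebesgue. f s) \<le> c * exp (2 * p * exp (- k * x)) / 2"
proof -
  note w = has_bochner_integral_weight[OF assms(1,2), of x]
  have "norm (LINT s:S|lebesgue. f s) \<le>
    (LINT s|lebesgue. c * (indicator {x..} s * (p * k * exp (- k * s) * exp (2 * p * exp (- k * s)))))"
    unfolding set_lebesgue_integral_def
  proof (rule Bochner_Integration.integral_norm_bound_integral)
    show "integrable lebesgue (\<lambda>s. indicator S s *\<^sub>R f s)"
      using int by (simp add: set_integrable_def)
    show "integrable lebesgue (\<lambda>s. c * (indicator {x..} s * (p * k * exp (- k * s) * exp (2 * p * exp (- k * s)))))"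
      using w by (intro integrable_mult_right) (simp only: has_bochner_integral_iff)
    fix s
    show "norm (indicator S s *\<^sub>R f s) \<le> c * (indicator {x..} s * (p * k * exp (- k * s) * exp (2 * p * exp (- k * s))))"
    proof (cases "s \<in> S")
      case True
      then have "s \<in> {x..}" using assms(4) by blast
      then show ?thesis using le[OF True] True by simp
    next
      case False
      then show ?thesis using assms(1-3) by simp
    qed
  qed
  also have "\<dots> = c * ((exp (2 * p * exp (- k * x)) - 1) / 2)"
    using w by (simp only: integral_mult_right_zero has_bochner_integral_iff)
  also have "\<dots> \<le> c * exp (2 * p * exp (- k * x)) / 2"
    using assms(3) by (simp add: field_simps)
  finally show ?thesis .
qed

lemma norm_vec_nth_nth_le: "norm (M $ r $ c) \<le> norm M"
  by (meson Finite_Cartesian_Product.norm_nth_le order_trans)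

section \<open>The kernel equations and the geometry of their characteristics\<close>

locale kernel_system =
  fixes \<xi> :: "'n::{finite,linorder} + 'n \<Rightarrow> real"
    and Q :: "real \<Rightarrow> (complex, 'n+'n) sqmat"
    and A :: "real \<Rightarrow> real \<Rightarrow> (complex, 'n+'n) sqmat"
    and C \<epsilon> :: real
  assumes mono1: "strict_mono (\<lambda>k. \<xi> (Inl k))" and neg: "\<And>k. \<xi> (Inl k) < 0"
    and mono2: "strict_mono (\<lambda>k. \<xi> (Inr k))" and pos: "\<And>k. 0 < \<xi> (Inr k)"
    and C_pos: "C > 0" and eps_pos: "\<epsilon> > 0"
    and Q_le: "\<And>x. x \<ge> 0 \<Longrightarrow> norm (Q x) \<le> C * exp (- \<epsilon> * x)"
    and kernels: "transformation_kernels \<xi> Q A"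
begin

text \<open>If v is the ratio belonging to the entry (r, c), the characteristic through (x,t) meets
  the diagonal at x + v * (t - x). The triangular patterns decide which entries contribute.\<close>

definition ratios :: "real set" where
  "ratios = {\<xi> (Inl j) / (\<xi> (Inl j) - \<xi> (Inl k)) | k j. k > j} \<union>
     {\<xi> (Inr j) / (\<xi> (Inr j) - \<xi> (Inl k)) | k j. index_pos k + index_pos j > CARD('n)} \<union>
     {\<xi> (Inl j) / (\<xi> (Inl j) - \<xi> (Inr k)) | k j. index_pos k + index_pos j < CARD('n) + 2} \<union>
     {\<xi> (Inr j) / (\<xi> (Inr j) - \<xi> (Inr k)) | k j. k < j}"

lemma theta_eq: "theta \<xi> = Min ratios"
  by (simp add: theta_def ratios_def)

text \<open>In the mixed blocks the two entries of \<sigma> have opposite signs; in the diagonal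
  blocks the index order matches the ordering of \<xi>. Either way numerator and denominator have
  the same sign.\<close>

lemma ratios_pos: "v \<in> ratios \<Longrightarrow> v > 0"
  using neg pos strict_monoD[OF mono1] strict_monoD[OF mono2] unfolding ratios_def
  by (auto simp: zero_less_divide_iff intro: less_trans[OF neg pos])

lemma finite_ratios: "finite ratios"
proof (rule finite_subset)
  show "ratios \<subseteq> (\<lambda>(c, r). \<xi> c / (\<xi> c - \<xi> r)) ` UNIV"
    unfolding ratios_def by auto
qed simp

text \<open>The pair of last indices has position sum 2n > n, so the upper right block contributes
  even for n = 1 and the minimum is a genuine one.\<close>

lemma ratios_nonempty: "ratios \<noteq> {}"
proof -
  have "index_pos (Max (UNIV :: 'n set)) = CARD('n)"
    by (simp add: index_pos_def atMost_def)
  then have "index_pos (Max (UNIV :: 'n set)) + index_pos (Max (UNIV :: 'n set)) > CARD('n)" by simp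
  then show ?thesis unfolding ratios_def by blast
qed

lemma theta_pos: "theta \<xi> > 0"
  unfolding theta_eq using Min_in[OF finite_ratios ratios_nonempty] ratios_pos by blast

lemma theta_le: "v \<in> ratios \<Longrightarrow> theta \<xi> \<le> v"
  unfolding theta_eq using Min_le[OF finite_ratios] by blast

lemma A_measurable: "x \<ge> 0 \<Longrightarrow> A x \<in> borel_measurable (lebesgue_on {x..})"
  using kernels by (simp add: transformation_kernels_def Let_def)

lemma A_bounded: "\<exists>M. \<forall>x t. 0 \<le> x \<and> x \<le> t \<longrightarrow> norm (A x t) \<le> M"
  using kernels by (simp add: transformation_kernels_def Let_def)

lemma sum_UNIV_Plus: "(\<Sum>l\<in>(UNIV :: ('n + 'n) set). f l) = (\<Sum>l\<in>UNIV. f (Inl l)) + (\<Sum>l\<in>UNIV. f (Inr l))"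
  for f :: "'n + 'n \<Rightarrow> complex"
proof -
  have "sum f (UNIV <+> UNIV) = (\<Sum>l\<in>UNIV. f (Inl l)) + (\<Sum>l\<in>UNIV. f (Inr l))"
    by (simp add: sum.Plus del: UNIV_Plus_UNIV)
  then show ?thesis by simp
qed

text \<open>The sums of block products in the equations are the blocks of the single product
  \<open>Q s ** A s \<tau>\<close>, so the six families of equations can be treated as one.\<close>

lemma block_mult:
  fixes M N :: "(complex, 'n+'n) sqmat"
  shows "block11 M ** block11 N + block12 M ** block21 N = block11 (M ** N)"
    "block21 M ** block11 N + block22 M ** block21 N = block21 (M ** N)"
    "block12 M ** block22 N + block11 M ** block12 N = block12 (M ** N)"
    "block21 M ** block12 N + block22 M ** block22 N = block22 (M ** N)"
  by (simp_all add: block11_def block12_def block21_def block22_def matrix_matrix_mult_def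
      vec_eq_iff sum_UNIV_Plus)

text \<open>Frees the later estimates from blocks: with r and c ranging over all 2n indices, an
  entry vanishes by the pattern, satisfies the diagonal equation, or satisfies the general one with
  a ratio bounded below by theta.\<close>

lemma kernel_cases:
  obtains (zero) "\<And>x t. 0 \<le> x \<Longrightarrow> x \<le> t \<Longrightarrow> A x t $ r $ c = 0"
  | (diag) "kernel_eq_diag (\<lambda>s \<tau>. (Q s ** A s \<tau>) $ r $ c) (\<lambda>x t. A x t $ r $ c)"
  | (eq) "\<xi> c / (\<xi> c - \<xi> r) \<in> ratios"
      "kernel_eq (\<xi> r) (\<xi> c) (\<lambda>s. Q s $ r $ c) (\<lambda>s \<tau>. (Q s ** A s \<tau>) $ r $ c) (\<lambda>x t. A x t $ r $ c)"
proof -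
  note K = kernels[unfolded transformation_kernels_def Let_def block_mult]
  have b: "block11 M $ k $ j = M $ Inl k $ Inl j" "block12 M $ k $ j = M $ Inl k $ Inr j"
    "block21 M $ k $ j = M $ Inr k $ Inl j" "block22 M $ k $ j = M $ Inr k $ Inr j"
    for M :: "(complex, 'n+'n) sqmat" and k j
    by (simp_all add: block11_def block12_def block21_def block22_def)
  show ?thesis
  proof (cases r; cases c)
    fix k j assume rc: "r = Inl k" "c = Inl j"
    consider "k < j" | "k = j" | "j < k" by force
    then show ?thesis
    proof cases
      case 1 then show ?thesis using K rc by (intro zero) (simp add: lower_triangular_def b)
    next
      case 2 then show ?thesis using K rc by (intro diag) (simp add: b)
    next
      case 3
      then have "\<xi> c / (\<xi> c - \<xi> r) \<in> ratios" using rc by (auto simp: ratios_def)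
      then show ?thesis using K rc 3 by (intro eq) (simp_all add: b)
    qed
  next
    fix k j assume rc: "r = Inl k" "c = Inr j"
    show ?thesis
    proof (cases "index_pos k + index_pos j > CARD('n)")
      case False then show ?thesis using K rc by (intro zero) (simp add: lower_anti_triangular_def b)
    next
      case True
      then have "\<xi> c / (\<xi> c - \<xi> r) \<in> ratios" using rc by (auto simp: ratios_def)
      then show ?thesis using K rc True by (intro eq) (simp_all add: b)
    qed
  next
    fix k j assume rc: "r = Inr k" "c = Inl j"
    show ?thesis
    proof (cases "index_pos k + index_pos j < CARD('n) + 2")
      case False then show ?thesis using K rc by (intro zero) (simp add: upper_anti_triangular_def b)
    next
      case True
      then have "\<xi> c / (\<xi> c - \<xi> r) \<in> ratios" using rc by (auto simp: ratios_def)
      then show ?thesis using K rc True by (intro eq) (simp_all add: b)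
    qed
  next
    fix k j assume rc: "r = Inr k" "c = Inr j"
    consider "j < k" | "k = j" | "k < j" by force
    then show ?thesis
    proof cases
      case 1 then show ?thesis using K rc by (intro zero) (simp add: upper_triangular_def b)
    next
      case 2 then show ?thesis using K rc by (intro diag) (simp add: b)
    next
      case 3
      then have "\<xi> c / (\<xi> c - \<xi> r) \<in> ratios" using rc by (auto simp: ratios_def)
      then show ?thesis using K rc 3 by (intro eq) (simp_all add: b)
    qed
  qed
qed

text \<open>The exponent of the expected decay: the entries are to be bounded by a multiple of exp
  (- \<epsilon> * \<open>front x t\<close>).\<close>

definition front :: "real \<Rightarrow> real \<Rightarrow> real" where
  "front x t = x + theta \<xi> * (t - x)"

text \<open>A product entry has 2n terms, each with a factor at most C exp (- \<epsilon> s).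
  Division by \<epsilon> writes the total as
  \<open>rate * \<epsilon> * exp (- \<epsilon> * s)\<close>, the shape required by the weight
  integral with p = \<open>rate\<close> and k = \<epsilon>.\<close>

definition rate :: real where
  "rate = CARD('n + 'n) * C / \<epsilon>"

definition wt :: "real \<Rightarrow> real \<Rightarrow> real \<Rightarrow> real" where
  "wt d x t = exp (2 * rate * exp (- \<epsilon> * x)) * (exp (- \<epsilon> * front x t) + d)"

text \<open>A crude common bound for the coefficients of all non-integral terms. The pairs with r =
  c contribute 0, since division by zero gives 0.\<close>

definition source :: real where
  "source = C * (\<Sum>(r, c)\<in>UNIV. \<bar>\<xi> c / (\<xi> c - \<xi> r)\<bar>)"

lemma rate_pos: "rate > 0"
  using C_pos eps_pos by (simp add: rate_def)

lemma source_nonneg: "source \<ge> 0"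
  using C_pos by (auto simp: source_def intro!: mult_nonneg_nonneg sum_nonneg)

lemma source_ge: "C * \<bar>\<xi> c / (\<xi> c - \<xi> r)\<bar> \<le> source"
proof -
  have "(\<lambda>(r, c). \<bar>\<xi> c / (\<xi> c - \<xi> r)\<bar>) (r, c) \<le> (\<Sum>(r, c)\<in>UNIV. \<bar>\<xi> c / (\<xi> c - \<xi> r)\<bar>)"
    by (rule member_le_sum) auto
  then show ?thesis unfolding source_def using C_pos by (intro mult_left_mono) auto
qed

lemma norm_Q_entry_le: "x \<ge> 0 \<Longrightarrow> norm (Q x $ r $ c) \<le> C * exp (- \<epsilon> * x)"
  using norm_vec_nth_nth_le Q_le order_trans by blast

lemma product_entry_le:
  assumes A_le: "\<And>l. norm (A s \<tau> $ l $ c) \<le> B" and "s \<ge> 0"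
  shows "norm ((Q s ** A s \<tau>) $ r $ c) \<le> rate * \<epsilon> * exp (- \<epsilon> * s) * B"
proof -
  have "norm ((Q s ** A s \<tau>) $ r $ c) \<le> (\<Sum>l\<in>UNIV. norm (Q s $ r $ l * A s \<tau> $ l $ c))"
    by (simp add: matrix_matrix_mult_def norm_sum)
  also have "\<dots> \<le> (\<Sum>l\<in>(UNIV :: ('n + 'n) set). C * exp (- \<epsilon> * s) * B)"
    unfolding norm_mult using C_pos \<open>s \<ge> 0\<close>
    by (intro sum_mono mult_mono norm_Q_entry_le A_le) auto
  also have "\<dots> = rate * \<epsilon> * exp (- \<epsilon> * s) * B"
    using eps_pos by (simp add: rate_def)
  finally show ?thesis .
qed

text \<open>The choice of \<open>theta\<close> makes \<open>front\<close> nondecreasing along characteristics.\<close>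

lemma front_characteristic:
  assumes v: "\<xi> c / (\<xi> c - \<xi> r) \<in> ratios" and "x \<le> t" "x \<le> s"
    and s: "s \<le> x + \<xi> c / (\<xi> c - \<xi> r) * (t - x)"
  shows "s \<le> t + \<xi> r / \<xi> c * (s - x)"
    and "front x t \<le> front s (t + \<xi> r / \<xi> c * (s - x))"
    and "front x t \<le> x + \<xi> c / (\<xi> c - \<xi> r) * (t - x)"
proof -
  define v where "v = \<xi> c / (\<xi> c - \<xi> r)"
  have v_pos: "v > 0" and v_ge: "theta \<xi> \<le> v"
    using ratios_pos[OF v] theta_le[OF v] by (auto simp: v_def)
  have nz: "\<xi> c \<noteq> 0" "\<xi> c - \<xi> r \<noteq> 0" using v_pos by (auto simp: v_def)
  \<comment> \<open>In terms of v the distance to the diagonal along the characteristic is (t - x) -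
    (s - x) / v, which shrinks to 0 exactly at s = x + v * (t - x).\<close>
  have ratio: "\<xi> r / \<xi> c = 1 - 1 / v" using nz by (simp add: v_def field_simps)
  have s_le: "(s - x) / v \<le> t - x" using s v_pos by (simp add: v_def[symmetric] field_simps)
  have \<tau>: "t + \<xi> r / \<xi> c * (s - x) = t + (s - x) - (s - x) / v"
    by (simp add: ratio field_simps)
  show "s \<le> t + \<xi> r / \<xi> c * (s - x)" using s_le unfolding \<tau> by simp
  \<comment> \<open>From x to s, \<open>front\<close> gains s - x and loses theta * (s - x) / v; the
    gain prevails because theta \<le> v.\<close>
  have "theta \<xi> * ((s - x) / v) \<le> v * ((s - x) / v)"
    using v_ge v_pos \<open>x \<le> s\<close> by (intro mult_right_mono) auto
  then have "theta \<xi> * ((s - x) / v) \<le> s - x" using v_pos by simp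
  then show "front x t \<le> front s (t + \<xi> r / \<xi> c * (s - x))"
    unfolding \<tau> front_def by (simp add: algebra_simps)
  show "front x t \<le> x + \<xi> c / (\<xi> c - \<xi> r) * (t - x)"
    using v_ge \<open>x \<le> t\<close> by (simp add: front_def v_def[symmetric] mult_right_mono)
qed

text \<open>Monotonicity of \<open>front\<close> freezes the decaying factor at its value in (x,t).
  What still depends on s is precisely the integrand of the weight integral.\<close>

lemma product_entry_le_wt:
  assumes A_le: "\<And>x t r c. 0 \<le> x \<Longrightarrow> x \<le> t \<Longrightarrow> norm (A x t $ r $ c) \<le> K * wt d x t"
    and "K \<ge> 0" "0 \<le> s" "s \<le> \<tau>" and front: "front x t \<le> front s \<tau>"
  shows "norm ((Q s ** A s \<tau>) $ r $ c) \<le>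
    K * (exp (- \<epsilon> * front x t) + d) * (rate * \<epsilon> * exp (- \<epsilon> * s) * exp (2 * rate * exp (- \<epsilon> * s)))"
proof -
  have "norm ((Q s ** A s \<tau>) $ r $ c) \<le> rate * \<epsilon> * exp (- \<epsilon> * s) * (K * wt d s \<tau>)"
    using assms by (intro product_entry_le A_le)
  also have "\<dots> \<le> rate * \<epsilon> * exp (- \<epsilon> * s) * (K * (exp (2 * rate * exp (- \<epsilon> * s)) * (exp (- \<epsilon> * front x t) + d)))"
    unfolding wt_def using front eps_pos rate_pos \<open>K \<ge> 0\<close> by (intro mult_left_mono) auto
  finally show ?thesis by (simp add: mult_ac)
qed

text \<open>
  The factor \<open>exp (2 * rate * exp (- \<epsilon> * x))\<close> of \<open>wt\<close> is chosen so that the integral operator halves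
  the constant in a bound by \<open>wt\<close>; the offset \<open>d > 0\<close> lets the iteration start from boundedness alone.
\<close>

lemma kernel_bound_step:
  assumes A_le: "\<And>x t r c. 0 \<le> x \<Longrightarrow> x \<le> t \<Longrightarrow> norm (A x t $ r $ c) \<le> K * wt d x t"
    and "K \<ge> 0" "d \<ge> 0" and xt: "0 \<le> x" "x \<le> t"
  shows "norm (A x t $ r $ c) \<le> (source + K / 2) * wt d x t"
proof -
  have wt_nonneg: "wt d x t \<ge> 0" using \<open>d \<ge> 0\<close> by (simp add: wt_def)
  have c_nonneg: "K * (exp (- \<epsilon> * front x t) + d) \<ge> 0"
    using \<open>d \<ge> 0\<close> \<open>K \<ge> 0\<close> by simp
  have split: "K / 2 * wt d x t = K * (exp (- \<epsilon> * front x t) + d) * exp (2 * rate * exp (- \<epsilon> * x)) / 2"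
    by (simp add: wt_def)
  have rate_nonneg: "rate \<ge> 0" using rate_pos by simp
  show ?thesis
  proof (cases rule: kernel_cases[of r c])
    case zero
    then show ?thesis using wt_nonneg source_nonneg \<open>K \<ge> 0\<close> xt by simp
  next
    case diag
    then have int: "set_integrable lebesgue {x..} (\<lambda>s. (Q s ** A s (t + (s - x))) $ r $ c)"
      and A_eq: "A x t $ r $ c = \<i> * (LINT s:{x..}|lebesgue. (Q s ** A s (t + (s - x))) $ r $ c)"
      using xt by (auto simp: kernel_eq_diag_def)
    have "norm (LINT s:{x..}|lebesgue. (Q s ** A s (t + (s - x))) $ r $ c) \<le> K / 2 * wt d x t"
      unfolding split
    proof (rule norm_set_integral_le_weight[OF rate_nonneg eps_pos c_nonneg order_refl int])
      \<comment> \<open>On a diagonal characteristic t - x is constant, so \<open>front\<close>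
        increases at speed 1 whatever theta is.\<close>
      fix s assume "s \<in> {x..}"
      then show "norm ((Q s ** A s (t + (s - x))) $ r $ c) \<le>
        K * (exp (- \<epsilon> * front x t) + d) * (rate * \<epsilon> * exp (- \<epsilon> * s) * exp (2 * rate * exp (- \<epsilon> * s)))"
        using xt by (intro product_entry_le_wt A_le \<open>K \<ge> 0\<close>) (auto simp: front_def)
    qed
    then show ?thesis
      using mult_nonneg_nonneg[OF source_nonneg wt_nonneg] by (simp add: A_eq norm_mult distrib_right)
  next
    case eq
    define u where "u = x + \<xi> c / (\<xi> c - \<xi> r) * (t - x)"
    have int: "set_integrable lebesgue {x..u} (\<lambda>s. (Q s ** A s (t + \<xi> r / \<xi> c * (s - x))) $ r $ c)"
      and A_eq: "A x t $ r $ c = \<i> * complex_of_real (\<xi> c / (\<xi> c - \<xi> r)) * Q u $ r $ c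
         + \<i> * (LINT s:{x..u}|lebesgue. (Q s ** A s (t + \<xi> r / \<xi> c * (s - x))) $ r $ c)"
      using eq(2) xt by (auto simp: kernel_eq_def u_def Let_def)
    have "u \<ge> x"
      using mult_nonneg_nonneg[of "\<xi> c / (\<xi> c - \<xi> r)" "t - x"] ratios_pos[OF eq(1)] xt
      unfolding u_def by linarith
    \<comment> \<open>The non-integral term evaluates Q at u, where the characteristic meets the
      diagonal, so this inequality makes its decay at least that of the weight.\<close>
    have "front x t \<le> u"
      using front_characteristic(3)[OF eq(1) xt(2) order_refl] \<open>u \<ge> x\<close> by (simp add: u_def)
    have "norm (LINT s:{x..u}|lebesgue. (Q s ** A s (t + \<xi> r / \<xi> c * (s - x))) $ r $ c) \<le> K / 2 * wt d x t"
      unfolding split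
    proof (rule norm_set_integral_le_weight[OF rate_nonneg eps_pos c_nonneg _ int])
      fix s assume "s \<in> {x..u}"
      then show "norm ((Q s ** A s (t + \<xi> r / \<xi> c * (s - x))) $ r $ c) \<le>
        K * (exp (- \<epsilon> * front x t) + d) * (rate * \<epsilon> * exp (- \<epsilon> * s) * exp (2 * rate * exp (- \<epsilon> * s)))"
        using xt front_characteristic(1,2)[OF eq(1) xt(2), of s]
        by (intro product_entry_le_wt A_le \<open>K \<ge> 0\<close>) (auto simp: u_def)
    qed auto
    moreover have "norm (\<i> * complex_of_real (\<xi> c / (\<xi> c - \<xi> r)) * Q u $ r $ c) \<le> source * wt d x t"
    proof -
      have "norm (\<i> * complex_of_real (\<xi> c / (\<xi> c - \<xi> r)) * Q u $ r $ c)
          \<le> \<bar>\<xi> c / (\<xi> c - \<xi> r)\<bar> * (C * exp (- \<epsilon> * u))"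
        unfolding norm_mult norm_of_real using norm_Q_entry_le[of u r c] \<open>u \<ge> x\<close> xt
        by (simp only: norm_ii mult_1) (intro mult_left_mono, auto)
      also have "\<dots> = (C * \<bar>\<xi> c / (\<xi> c - \<xi> r)\<bar>) * exp (- \<epsilon> * u)" by (simp add: mult_ac)
      also have "\<dots> \<le> source * wt d x t"
      proof (intro mult_mono source_ge source_nonneg)
        have "exp (- \<epsilon> * u) \<le> 1 * (exp (- \<epsilon> * front x t) + d)"
          using \<open>front x t \<le> u\<close> eps_pos \<open>d \<ge> 0\<close> by (simp add: add_increasing2)
        also have "\<dots> \<le> wt d x t"
          unfolding wt_def using rate_pos \<open>d \<ge> 0\<close> by (intro mult_right_mono) auto
        finally show "exp (- \<epsilon> * u) \<le> wt d x t" .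
      qed auto
      finally show ?thesis .
    qed
    ultimately show ?thesis
      unfolding A_eq by (intro norm_triangle_le) (simp add: norm_mult distrib_right)
  qed
qed

text \<open>The value 2 * \<open>source\<close> is the fixed point of the map taking K to
  \<open>source\<close> + K / 2. Since \<open>wt\<close> is at least d, the bound M is at most M / d
  times the weight; this excess over the fixed point is halved in every round.\<close>

lemma kernel_bound_iterate:
  assumes "d > 0" and M: "\<And>x t. 0 \<le> x \<Longrightarrow> x \<le> t \<Longrightarrow> norm (A x t) \<le> M"
    and "0 \<le> x" "x \<le> t"
  shows "norm (A x t $ r $ c) \<le> (2 * source + (M / d) / 2 ^ m) * wt d x t"
  using \<open>0 \<le> x\<close> \<open>x \<le> t\<close>
proof (induction m arbitrary: x t r c)
  case 0
  have "M \<ge> 0" using M[OF 0] norm_ge_zero order_trans by blast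
  have "norm (A x t $ r $ c) \<le> M / d * d"
    using M[OF 0] norm_vec_nth_nth_le[of "A x t" r c] \<open>d > 0\<close> by simp
  also have "\<dots> \<le> (2 * source + M / d) * wt d x t"
  proof (intro mult_mono)
    have "1 * (0 + d) \<le> wt d x t"
      unfolding wt_def using rate_pos \<open>d > 0\<close> by (intro mult_mono add_mono) auto
    then show "d \<le> wt d x t" by simp
  qed (use source_nonneg \<open>M \<ge> 0\<close> \<open>d > 0\<close> in auto)
  finally show ?case by simp
next
  case (Suc m)
  have "M \<ge> 0" using M[OF Suc.prems] norm_ge_zero order_trans by blast
  then have "2 * source + (M / d) / 2 ^ m \<ge> 0" using source_nonneg \<open>d > 0\<close> by simp
  then have "norm (A x t $ r $ c) \<le> (source + (2 * source + (M / d) / 2 ^ m) / 2) * wt d x t"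
    using kernel_bound_step[OF Suc.IH _ _ Suc.prems] \<open>d > 0\<close> by simp
  then show ?case by (simp add: add_divide_distrib mult_ac)
qed

text \<open>The order of the limits matters: the excess M / d blows up as d tends to 0, so it is
  removed by letting m tend to infinity for fixed d, before d tends to 0 from the right.\<close>

lemma kernel_bound:
  assumes "0 \<le> x" "x \<le> t"
  shows "norm (A x t $ r $ c) \<le> 2 * source * wt 0 x t"
proof -
  obtain M where M: "\<And>x t. 0 \<le> x \<Longrightarrow> x \<le> t \<Longrightarrow> norm (A x t) \<le> M"
    using A_bounded by blast
  have le: "norm (A x t $ r $ c) \<le> 2 * source * wt d x t" if "d > 0" for d
  proof (rule LIMSEQ_le_const)
    have "(\<lambda>m. (2 * source + (M / d) * (1 / 2) ^ m) * wt d x t) \<longlonglongrightarrow> (2 * source + (M / d) * 0) * wt d x t"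
      by (intro tendsto_mult tendsto_add tendsto_const LIMSEQ_power_zero) auto
    then show "(\<lambda>m. (2 * source + (M / d) / 2 ^ m) * wt d x t) \<longlonglongrightarrow> 2 * source * wt d x t"
      by (simp add: power_one_over)
    show "\<exists>N. \<forall>m\<ge>N. norm (A x t $ r $ c) \<le> (2 * source + (M / d) / 2 ^ m) * wt d x t"
      using kernel_bound_iterate[OF that M assms] by blast
  qed
  show ?thesis
  proof (rule tendsto_lowerbound)
    show "((\<lambda>d. 2 * source * wt d x t) \<longlongrightarrow> 2 * source * wt 0 x t) (at_right 0)"
      unfolding wt_def by (intro tendsto_intros)
    show "eventually (\<lambda>d. norm (A x t $ r $ c) \<le> 2 * source * wt d x t) (at_right 0)"
      using le by (auto simp: eventually_at_right_less eventually_at_filter)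
  qed simp
qed

end

section \<open>Matrix functions\<close>

lemma matrix_inv_mult:
  assumes "det A \<noteq> (0::complex)"
  shows "A ** matrix_inv A = mat 1" "matrix_inv A ** A = mat 1"
proof -
  have "invertible A" using assms by (simp add: invertible_det_nz)
  then show "A ** matrix_inv A = mat 1" "matrix_inv A ** A = mat 1"
    using someI_ex[of "\<lambda>A'. A ** A' = mat 1 \<and> A' ** A = mat 1"] by (auto simp: invertible_def matrix_inv_def)
qed

lemma matrix_inv_unique_complex:
  fixes A B :: "complex^'n^'n"
  assumes "A ** B = mat 1"
  shows "matrix_inv A = B"
proof -
  have "det A * det B = 1" using assms by (metis det_I det_mul)
  then have "det A \<noteq> 0" by auto
  then have "B = matrix_inv A ** (A ** B)" by (simp add: matrix_mul_assoc matrix_inv_mult)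
  then show ?thesis using assms by simp
qed

text \<open>Column j of the inverse solves a linear system with the j-th unit vector as right-hand
  side. Having the entries as quotients of determinants reduces limits and meromorphy of inverses to
  sums and products of entries.\<close>

lemma matrix_inv_cramer:
  fixes A :: "complex^'n^'n"
  assumes "det A \<noteq> 0"
  shows "matrix_inv A $ k $ j = det (\<chi> i l. if l = k then axis j 1 $ i else A $ i $ l) / det A"
proof -
  have "A *v (matrix_inv A *v axis j 1) = axis j 1"
    by (simp add: matrix_vector_mul_assoc matrix_inv_mult[OF assms])
  then have "matrix_inv A *v axis j 1 = (\<chi> k. det (\<chi> i l. if l = k then axis j 1 $ i else A $ i $ l) / det A)"
    using cramer[OF assms] by blast
  moreover have "(matrix_inv A *v axis j 1) $ k = matrix_inv A $ k $ j"
    by (simp add: matrix_vector_mult_def axis_def if_distrib cong: if_cong)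
  ultimately show ?thesis by simp
qed

lemma tendsto_det:
  fixes F :: "'a \<Rightarrow> complex^'n^'n"
  assumes "\<And>i j. ((\<lambda>z. F z $ i $ j) \<longlongrightarrow> L $ i $ j) G"
  shows "((\<lambda>z. det (F z)) \<longlongrightarrow> det L) G"
  unfolding det_def by (intro tendsto_sum tendsto_mult tendsto_prod tendsto_const assms)

lemma tendsto_vec_nth_nth:
  assumes "(F \<longlongrightarrow> L) G"
  shows "((\<lambda>z. F z $ i $ j) \<longlongrightarrow> L $ i $ j) G"
  by (intro tendsto_vec_nth assms)

lemma tendsto_matrix_mult:
  fixes F :: "'a \<Rightarrow> complex^'n^'m" and F' :: "'a \<Rightarrow> complex^'k^'n"
  assumes "(F \<longlongrightarrow> L) G" "(F' \<longlongrightarrow> L') G"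
  shows "((\<lambda>z. F z ** F' z) \<longlongrightarrow> L ** L') G"
proof (intro vec_tendstoI)
  fix i j
  have "((\<lambda>z. \<Sum>k\<in>UNIV. F z $ i $ k * F' z $ k $ j) \<longlongrightarrow> (\<Sum>k\<in>UNIV. L $ i $ k * L' $ k $ j)) G"
    by (rule tendsto_sum, rule tendsto_mult[OF tendsto_vec_nth_nth tendsto_vec_nth_nth]) (rule assms)+
  then show "((\<lambda>z. (F z ** F' z) $ i $ j) \<longlongrightarrow> (L ** L') $ i $ j) G"
    by (simp add: matrix_matrix_mult_def)
qed

text \<open>Cramer's quotient agrees with the inverse only where the determinant is nonzero; a
  nonzero limit of the determinants guarantees this eventually.\<close>

lemma tendsto_matrix_inv:
  fixes F :: "'a \<Rightarrow> complex^'n^'n"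
  assumes lim: "(F \<longlongrightarrow> L) G" and nz: "det L \<noteq> 0"
  shows "((\<lambda>z. matrix_inv (F z)) \<longlongrightarrow> matrix_inv L) G"
proof (intro vec_tendstoI)
  fix k j
  have lim_det: "((\<lambda>z. det (F z)) \<longlongrightarrow> det L) G"
    by (rule tendsto_det[OF tendsto_vec_nth_nth[OF lim]])
  have "((\<lambda>z. det (\<chi> i l. if l = k then axis j 1 $ i else F z $ i $ l) / det (F z)) \<longlongrightarrow>
      det (\<chi> i l. if l = k then axis j 1 $ i else L $ i $ l) / det L) G"
  proof (rule tendsto_divide[OF tendsto_det lim_det nz])
    show "((\<lambda>z. (\<chi> i l. if l = k then axis j 1 $ i else F z $ i $ l) $ a $ b) \<longlongrightarrow>
       (\<chi> i l. if l = k then axis j 1 $ i else L $ i $ l) $ a $ b) G" for a b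
      using tendsto_vec_nth_nth[OF lim] by (cases "b = k") auto
  qed
  moreover have "eventually (\<lambda>z. det (F z) \<noteq> 0) G"
    using lim_det nz by (rule tendsto_imp_eventually_ne)
  then have "eventually (\<lambda>z. det (\<chi> i l. if l = k then axis j 1 $ i else F z $ i $ l) / det (F z)
      = matrix_inv (F z) $ k $ j) G"
    by (rule eventually_mono) (simp add: matrix_inv_cramer)
  ultimately show "((\<lambda>z. matrix_inv (F z) $ k $ j) \<longlongrightarrow> matrix_inv L $ k $ j) G"
    unfolding matrix_inv_cramer[OF nz] by (rule Lim_transform_eventually)
qed

lemma meromorphic_on_det:
  fixes F :: "complex \<Rightarrow> complex^'n^'n"
  assumes "matrix_meromorphic_on F S"
  shows "(\<lambda>z. det (F z)) meromorphic_on S"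
  using assms unfolding det_def matrix_meromorphic_on_def
  by (intro meromorphic_on_sum meromorphic_on_mult meromorphic_on_prod meromorphic_on_const) auto

lemma matrix_meromorphic_on_mult:
  fixes F :: "complex \<Rightarrow> complex^'n^'m" and F' :: "complex \<Rightarrow> complex^'k^'n"
  assumes "matrix_meromorphic_on F S" "matrix_meromorphic_on F' S"
  shows "matrix_meromorphic_on (\<lambda>z. F z ** F' z) S"
  unfolding matrix_meromorphic_on_def matrix_matrix_mult_def vec_lambda_beta
  using assms unfolding matrix_meromorphic_on_def
  by (intro allI meromorphic_on_sum meromorphic_on_mult) auto

text \<open>At a singular matrix \<open>matrix_inv\<close> has an unspecified value. Meromorphy
  depends only on punctured neighbourhoods, so it is enough that the zeros of the determinant are
  isolated.\<close>

lemma matrix_meromorphic_on_inv: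
  fixes F :: "complex \<Rightarrow> complex^'n^'n"
  assumes F: "matrix_meromorphic_on F S"
    and nz: "\<And>z. z \<in> S \<Longrightarrow> eventually (\<lambda>w. det (F w) \<noteq> 0) (at z)"
  shows "matrix_meromorphic_on (\<lambda>z. matrix_inv (F z)) S"
  unfolding matrix_meromorphic_on_def
proof (intro allI)
  fix k j
  have "matrix_meromorphic_on (\<lambda>z. \<chi> i l. if l = k then axis j 1 $ i else F z $ i $ l) S"
    unfolding matrix_meromorphic_on_def
  proof (intro allI)
    fix a b
    show "(\<lambda>z. (\<chi> i l. if l = k then axis j 1 $ i else F z $ i $ l) $ a $ b) meromorphic_on S"
      using F by (cases "b = k") (auto simp: matrix_meromorphic_on_def)
  qed
  then have "(\<lambda>z. det (\<chi> i l. if l = k then axis j 1 $ i else F z $ i $ l) / det (F z)) meromorphic_on S"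
    by (intro meromorphic_on_divide meromorphic_on_det F)
  moreover have "(\<lambda>w. det (\<chi> i l. if l = k then axis j 1 $ i else F w $ i $ l) / det (F w)) meromorphic_on S
      \<longleftrightarrow> (\<lambda>w. matrix_inv (F w) $ k $ j) meromorphic_on S"
  proof (rule meromorphic_on_cong[OF _ refl])
    fix z assume "z \<in> S"
    then show "eventually (\<lambda>w. det (\<chi> i l. if l = k then axis j 1 $ i else F w $ i $ l) / det (F w)
        = matrix_inv (F w) $ k $ j) (at z)"
      by (rule eventually_mono[OF nz]) (simp add: matrix_inv_cramer)
  qed
  ultimately show "(\<lambda>z. matrix_inv (F z) $ k $ j) meromorphic_on S" by (rule iffD1[rotated])
qed

lemma tendsto_imp_not_matrix_pole:
  assumes "(F \<longlongrightarrow> L) (at z)"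
  shows "\<not> matrix_pole F z"
  unfolding matrix_pole_def is_pole_def
proof safe
  fix k j assume "filterlim (\<lambda>w. F w $ k $ j) at_infinity (at z)"
  then show False
    by (rule not_tendsto_and_filterlim_at_infinity[OF trivial_limit_at tendsto_vec_nth_nth[OF assms]])
qed

lemma integrable_vec:
  fixes f :: "'a \<Rightarrow> ('b::euclidean_space, 'n::finite) vec"
  assumes "\<And>i. integrable M (\<lambda>x. f x $ i)"
  shows "integrable M f"
proof -
  have lin: "bounded_linear (axis i :: 'b \<Rightarrow> ('b, 'n) vec)" for i
    unfolding linear_conv_bounded_linear[symmetric]
    by (rule linearI) (auto simp: vec_eq_iff axis_def)
  have "integrable M (\<lambda>x. \<Sum>i\<in>UNIV. axis i (f x $ i))"
    by (rule Bochner_Integration.integrable_sum) (rule integrable_bounded_linear[OF lin assms])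
  moreover have "f x = (\<Sum>i\<in>UNIV. axis i (f x $ i))" for x
    by (simp add: vec_eq_iff axis_def if_distrib sum.delta cong: if_cong)
  ultimately show ?thesis by simp
qed

lemma integral_vec_nth:
  fixes f :: "'a \<Rightarrow> ('b::euclidean_space, 'n::finite) vec"
  assumes "integrable M f"
  shows "(LINT x|M. f x) $ i = (LINT x|M. f x $ i)"
  using integral_bounded_linear[OF bounded_linear_vec_nth assms] by simp

section \<open>Transforms of the kernels and the scattering matrix\<close>

abbreviation (input) strip_at_infinity :: "real \<Rightarrow> complex filter" where
  "strip_at_infinity \<delta> \<equiv> inf at_infinity (principal {z. \<bar>Im z\<bar> \<le> \<delta>})"

text \<open>Re (\<i> z \<eta>) = - \<eta> * Im z is at most \<delta> * \<bar>\<eta>\<bar> on the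
  strip for either sign of \<eta>, so one statement serves both halves of \<sigma>.\<close>

lemma filterlim_rotate_strip:
  fixes \<eta> :: real
  assumes "\<eta> \<noteq> 0"
  shows "filterlim (\<lambda>z. \<i> * z * complex_of_real \<eta>) (inf at_infinity (principal {c. Re c \<le> \<delta> * \<bar>\<eta>\<bar>}))
    (strip_at_infinity \<delta>)"
proof (rule filterlim_inf[THEN iffD2], intro conjI)
  have "filterlim (\<lambda>z. (\<i> * complex_of_real \<eta>) * z) at_infinity at_infinity"
    using assms by (intro tendsto_mult_filterlim_at_infinity[OF tendsto_const] filterlim_ident) auto
  then show "filterlim (\<lambda>z. \<i> * z * complex_of_real \<eta>) at_infinity (strip_at_infinity \<delta>)"
    by (auto intro: filterlim_mono simp: mult_ac)
  have "- (\<eta> * Im z) \<le> \<delta> * \<bar>\<eta>\<bar>" if "\<bar>Im z\<bar> \<le> \<delta>" for z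
  proof -
    have "- (\<eta> * Im z) \<le> \<bar>Im z\<bar> * \<bar>\<eta>\<bar>"
      using abs_ge_minus_self[of "\<eta> * Im z"] by (simp add: abs_mult mult.commute)
    then show ?thesis using mult_right_mono[OF that, of "\<bar>\<eta>\<bar>"] by simp
  qed
  then show "filterlim (\<lambda>z. \<i> * z * complex_of_real \<eta>) (principal {c. Re c \<le> \<delta> * \<bar>\<eta>\<bar>}) (strip_at_infinity \<delta>)"
    by (auto simp: filterlim_principal eventually_inf_principal mult_ac)
qed

text \<open>For \<delta> \<ge> 0 the strip contains the unbounded real axis. This allows an actual
  point to be extracted from an eventual property.\<close>

lemma strip_at_infinity_neq_bot:
  assumes "\<delta> \<ge> 0"
  shows "strip_at_infinity \<delta> \<noteq> bot"
proof
  assume "strip_at_infinity \<delta> = bot"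
  then have "eventually (\<lambda>z. False) (strip_at_infinity \<delta>)" by simp
  then obtain b where b: "\<And>z. norm z \<ge> b \<Longrightarrow> \<not> \<bar>Im z\<bar> \<le> \<delta>"
    by (auto simp: eventually_inf_principal eventually_at_infinity)
  show False using b[of "complex_of_real \<bar>b\<bar>"] assms abs_ge_self[of b] by simp
qed

context
  fixes \<eta> :: "'n::finite \<Rightarrow> real" and K :: "real \<Rightarrow> real \<Rightarrow> (complex, 'n) sqmat" and B \<kappa> :: real
  assumes decay: "\<And>k j. exp_decaying (\<lambda>t. K 0 t $ k $ j) B \<kappa>"
begin

text \<open>The diagonal factor on the right gives column j the exponent \<open>\<eta> j\<close>.
  The rate condition covers all columns because the matrix integral can be taken entrywise only if
  the whole matrix function is integrable; otherwise it is 0 by convention.\<close>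

lemma kernel_transform_nth:
  assumes "\<And>j. - Im z * \<eta> j < \<kappa>"
  shows "kernel_transform \<eta> K z $ k $ j = laplace (\<lambda>t. K 0 t $ k $ j) (\<i> * z * complex_of_real (\<eta> j))"
proof -
  define f where "f = (\<lambda>t. indicator {0..} t *\<^sub>R (K 0 t ** diag_matrix (\<lambda>j. exp (\<i> * z * complex_of_real (\<eta> j * t)))))"
  have f: "f t $ k $ j = indicator {0..} t *\<^sub>R (K 0 t $ k $ j * exp (\<i> * z * complex_of_real (\<eta> j) * complex_of_real t))" for t k j
    by (simp add: f_def matrix_matrix_mult_def diag_matrix_def if_distrib mult_ac cong: if_cong)
  have int: "integrable lebesgue (\<lambda>t. f t $ k $ j)" for k j
    unfolding f using assms[of j] by (intro exp_decaying.integrable_transform[OF decay]) simp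
  then have int': "integrable lebesgue (\<lambda>t. f t $ k)" for k
    by (rule integrable_vec)
  then have "integrable lebesgue f" by (rule integrable_vec)
  then have "(LINT t|lebesgue. f t) $ k $ j = (LINT t|lebesgue. f t $ k $ j)"
    by (simp add: integral_vec_nth int')
  then show ?thesis
    unfolding f by (simp add: kernel_transform_def set_lebesgue_integral_def laplace_def f_def)
qed

lemma holomorphic_kernel_transform:
  assumes "open U" "\<And>z j. z \<in> U \<Longrightarrow> - Im z * \<eta> j < \<kappa>"
  shows "(\<lambda>z. kernel_transform \<eta> K z $ k $ j) holomorphic_on U"
proof -
  have "(laplace (\<lambda>t. K 0 t $ k $ j) \<circ> (\<lambda>z. \<i> * z * complex_of_real (\<eta> j))) holomorphic_on U"
    using assms(2) by (intro holomorphic_on_compose_gen[OF _ exp_decaying.holomorphic_laplace[OF decay]])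
      (auto intro!: holomorphic_intros)
  then show ?thesis
    by (rule holomorphic_transform) (simp only: comp_def kernel_transform_nth[OF assms(2)])
qed

lemma kernel_transform_tendsto_0:
  assumes "\<And>j. \<eta> j \<noteq> 0" "\<And>j. \<delta> * \<bar>\<eta> j\<bar> < \<kappa>"
  shows "(kernel_transform \<eta> K \<longlongrightarrow> 0) (strip_at_infinity \<delta>)"
proof (intro vec_tendstoI)
  fix k j
  have "((\<lambda>z. laplace (\<lambda>t. K 0 t $ k $ j) (\<i> * z * complex_of_real (\<eta> j))) \<longlongrightarrow> 0) (strip_at_infinity \<delta>)"
    by (rule filterlim_compose[OF exp_decaying.laplace_tendsto_0[OF decay] filterlim_rotate_strip]) (use assms in auto)
  moreover have "eventually (\<lambda>z. laplace (\<lambda>t. K 0 t $ k $ j) (\<i> * z * complex_of_real (\<eta> j)) =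
      kernel_transform \<eta> K z $ k $ j) (strip_at_infinity \<delta>)"
  proof -
    have "- Im z * \<eta> j < \<kappa>" if "\<bar>Im z\<bar> \<le> \<delta>" for z j
    proof -
      have "- Im z * \<eta> j \<le> \<bar>Im z\<bar> * \<bar>\<eta> j\<bar>"
        using abs_ge_minus_self[of "Im z * \<eta> j"] by (simp add: abs_mult)
      also have "\<dots> \<le> \<delta> * \<bar>\<eta> j\<bar>" using that by (rule mult_right_mono) simp
      finally show ?thesis using assms(2)[of j] by simp
    qed
    then show ?thesis by (auto simp: eventually_inf_principal kernel_transform_nth)
  qed
  ultimately have "((\<lambda>z. kernel_transform \<eta> K z $ k $ j) \<longlongrightarrow> 0) (strip_at_infinity \<delta>)"
    by (rule Lim_transform_eventually)
  then show "((\<lambda>z. kernel_transform \<eta> K z $ k $ j) \<longlongrightarrow> 0 $ k $ j) (strip_at_infinity \<delta>)"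
    by simp
qed

end

definition matrix_holomorphic_on :: "(complex \<Rightarrow> complex^'m^'n) \<Rightarrow> complex set \<Rightarrow> bool" where
  "matrix_holomorphic_on F S \<longleftrightarrow> (\<forall>k j. (\<lambda>z. F z $ k $ j) holomorphic_on S)"

lemma matrix_holomorphic_on_const: "matrix_holomorphic_on (\<lambda>z. M) S"
  by (simp add: matrix_holomorphic_on_def)

lemma matrix_holomorphic_on_add:
  "matrix_holomorphic_on F S \<Longrightarrow> matrix_holomorphic_on G S \<Longrightarrow> matrix_holomorphic_on (\<lambda>z. F z + G z) S"
  by (auto simp: matrix_holomorphic_on_def intro!: holomorphic_intros)

lemma matrix_holomorphic_on_diff:
  "matrix_holomorphic_on F S \<Longrightarrow> matrix_holomorphic_on G S \<Longrightarrow> matrix_holomorphic_on (\<lambda>z. F z - G z) S"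
  by (auto simp: matrix_holomorphic_on_def intro!: holomorphic_intros)

lemma matrix_holomorphic_on_mult:
  fixes F :: "complex \<Rightarrow> complex^'n^'m" and G :: "complex \<Rightarrow> complex^'k^'n"
  shows "matrix_holomorphic_on F S \<Longrightarrow> matrix_holomorphic_on G S \<Longrightarrow> matrix_holomorphic_on (\<lambda>z. F z ** G z) S"
  by (auto simp: matrix_holomorphic_on_def matrix_matrix_mult_def intro!: holomorphic_intros)

lemma holomorphic_on_det:
  fixes F :: "complex \<Rightarrow> complex^'n^'n"
  assumes "matrix_holomorphic_on F S"
  shows "(\<lambda>z. det (F z)) holomorphic_on S"
  using assms unfolding det_def matrix_holomorphic_on_def
  by (intro holomorphic_on_sum holomorphic_on_mult holomorphic_on_prod holomorphic_on_const) auto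

lemma matrix_holomorphic_imp_meromorphic:
  "matrix_holomorphic_on F S \<Longrightarrow> open S \<Longrightarrow> matrix_meromorphic_on F S"
  by (auto simp: matrix_holomorphic_on_def matrix_meromorphic_on_def analytic_on_open
      intro: analytic_on_imp_meromorphic_on)

lemma matrix_meromorphic_on_subset:
  "matrix_meromorphic_on F S \<Longrightarrow> T \<subseteq> S \<Longrightarrow> matrix_meromorphic_on F T"
  by (auto simp: matrix_meromorphic_on_def intro: meromorphic_on_subset)

lemma matrix_holomorphic_on_tendsto:
  assumes "matrix_holomorphic_on F S" "open S" "z \<in> S"
  shows "(F \<longlongrightarrow> F z) (at z)"
proof (intro vec_tendstoI)
  fix k j
  have "continuous_on S (\<lambda>z. F z $ k $ j)"
    using assms(1) holomorphic_on_imp_continuous_on by (auto simp: matrix_holomorphic_on_def)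
  then have "isCont (\<lambda>z. F z $ k $ j) z"
    using assms by (simp add: continuous_on_eq_continuous_at)
  then show "((\<lambda>z. F z $ k $ j) \<longlongrightarrow> F z $ k $ j) (at z)"
    by (simp add: isCont_def)
qed

locale scattering = kernel_system +
  fixes H :: "(complex, 'a::{finite,linorder}) sqmat"
begin

section \<open>The two half-planes and the two factors of the scattering matrix\<close>

definition width_plus :: real where
  "width_plus = theta \<xi> / \<xi> (Inr (Max UNIV)) * \<epsilon>"

definition width_minus :: real where
  "width_minus = - (theta \<xi> / \<xi> (Inl (Min UNIV)) * \<epsilon>)"

definition half_plus :: "complex set" where
  "half_plus = {z. Im z > - width_plus}"

definition half_minus :: "complex set" where
  "half_minus = {z. Im z < width_minus}"

text \<open>This and \<open>jost_minus\<close> play the role of Jost matrices: the scattering matrix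
  is a quotient of two matrices holomorphic in opposite half-planes that overlap in a strip around
  the real axis.\<close>

definition jost_plus :: "complex \<Rightarrow> (complex, 'a) sqmat" where
  "jost_plus z = mat 1 + A_H_plus \<xi> H A z"

definition jost_minus :: "complex \<Rightarrow> (complex, 'a) sqmat" where
  "jost_minus z = mat 1 + A_H_minus \<xi> H A z"

lemma scattering_matrix_eq: "scattering_matrix \<xi> H A z = matrix_inv (jost_plus z) ** jost_minus z"
  by (simp add: scattering_matrix_def jost_plus_def jost_minus_def)

lemma width_pos: "width_plus > 0" "width_minus > 0"
proof -
  show "width_plus > 0"
    unfolding width_plus_def using theta_pos pos eps_pos by simp
  have "theta \<xi> / \<xi> (Inl (Min UNIV)) * \<epsilon> < 0"
    using theta_pos neg[of "Min UNIV"] eps_pos by (intro mult_neg_pos divide_pos_neg)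
  then show "width_minus > 0" by (simp add: width_minus_def)
qed

lemma Inr_le_last: "\<xi> (Inr j) \<le> \<xi> (Inr (Max UNIV))"
  using strict_mono_mono[OF mono2] by (simp add: mono_def)

lemma Inl_ge_first: "\<xi> (Inl (Min UNIV)) \<le> \<xi> (Inl j)"
  using strict_mono_mono[OF mono1] by (simp add: mono_def)

text \<open>The last index has the largest positive entry and gives equality, so it alone limits the
  width. For the negative entries the first index has the largest modulus.\<close>

lemma width_plus_mult: "width_plus * \<xi> (Inr j) \<le> \<epsilon> * theta \<xi>"
proof -
  have "width_plus * \<xi> (Inr j) \<le> width_plus * \<xi> (Inr (Max UNIV))"
    using width_pos Inr_le_last by (intro mult_left_mono) auto
  also have "\<dots> = \<epsilon> * theta \<xi>" using pos[of "Max UNIV"] by (simp add: width_plus_def)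
  finally show ?thesis .
qed

lemma width_minus_mult: "width_minus * - \<xi> (Inl j) \<le> \<epsilon> * theta \<xi>"
proof -
  have "width_minus * - \<xi> (Inl j) \<le> width_minus * - \<xi> (Inl (Min UNIV))"
    using width_pos Inl_ge_first by (intro mult_left_mono) auto
  also have "\<dots> = \<epsilon> * theta \<xi>" using neg[of "Min UNIV"] by (simp add: width_minus_def)
  finally show ?thesis .
qed

lemma below_width_plus:
  assumes "y < width_plus"
  shows "y * \<xi> (Inr j) < \<epsilon> * theta \<xi>"
  using mult_strict_right_mono[OF assms pos] width_plus_mult by (rule less_le_trans)

lemma below_width_minus:
  assumes "y < width_minus"
  shows "y * - \<xi> (Inl j) < \<epsilon> * theta \<xi>"
proof -
  have "0 < - \<xi> (Inl j)" using neg[of j] by simp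
  then show ?thesis using mult_strict_right_mono[OF assms] width_minus_mult less_le_trans by blast
qed

text \<open>The left side is the growth rate of exp (\<i> z \<xi> t) for the column in question;
  below \<epsilon> * theta it is beaten by the decay of the kernels.\<close>

lemma half_plus_rate: "z \<in> half_plus \<Longrightarrow> - Im z * \<xi> (Inr j) < \<epsilon> * theta \<xi>"
  using below_width_plus[of "- Im z" j] by (simp add: half_plus_def)

lemma half_minus_rate: "z \<in> half_minus \<Longrightarrow> - Im z * \<xi> (Inl j) < \<epsilon> * theta \<xi>"
  using below_width_minus[of "Im z" j] by (simp add: half_minus_def)

text \<open>At x = 0 the quantity \<open>front\<close> equals theta * t, and the outer factor of the
  weight is the constant exp (2 * \<open>rate\<close>).\<close>

lemma exp_decaying_entry:
  "exp_decaying (\<lambda>t. A 0 t $ r $ c) (2 * source * exp (2 * rate)) (\<epsilon> * theta \<xi>)"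
proof
  have "A 0 \<in> borel_measurable (lebesgue_on {0..})" by (rule A_measurable) simp
  moreover have "(\<lambda>M. M $ r $ c) \<in> borel_measurable (borel :: (complex, 'a + 'a) sqmat measure)"
    by (intro borel_measurable_continuous_onI continuous_intros)
  ultimately show "(\<lambda>t. A 0 t $ r $ c) \<in> borel_measurable (lebesgue_on {0..})"
    by (rule measurable_compose)
  fix t :: real assume "t \<ge> 0"
  then show "norm (A 0 t $ r $ c) \<le> 2 * source * exp (2 * rate) * exp (- (\<epsilon> * theta \<xi>) * t)"
    using kernel_bound[of 0 t r c] by (simp add: wt_def front_def mult_ac)
qed

lemma exp_decaying_blocks:
  "exp_decaying (\<lambda>t. block11 (A 0 t) $ k $ j) (2 * source * exp (2 * rate)) (\<epsilon> * theta \<xi>)"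
  "exp_decaying (\<lambda>t. block12 (A 0 t) $ k $ j) (2 * source * exp (2 * rate)) (\<epsilon> * theta \<xi>)"
  "exp_decaying (\<lambda>t. block21 (A 0 t) $ k $ j) (2 * source * exp (2 * rate)) (\<epsilon> * theta \<xi>)"
  "exp_decaying (\<lambda>t. block22 (A 0 t) $ k $ j) (2 * source * exp (2 * rate)) (\<epsilon> * theta \<xi>)"
  using exp_decaying_entry by (simp_all add: block11_def block12_def block21_def block22_def)

lemma open_half: "open half_plus" "open half_minus"
  by (simp_all add: half_plus_def half_minus_def open_halfspace_Im_gt open_halfspace_Im_lt)

lemma convex_half: "convex half_plus" "convex half_minus"
  by (simp_all add: half_plus_def half_minus_def convex_halfspace_Im_gt convex_halfspace_Im_lt)

lemma holomorphic_jost_plus: "matrix_holomorphic_on jost_plus half_plus"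
proof -
  have 1: "matrix_holomorphic_on (kernel_transform (\<lambda>j. \<xi> (Inr j)) (\<lambda>x t. block22 (A x t))) half_plus"
    unfolding matrix_holomorphic_on_def
    by (intro allI holomorphic_kernel_transform[where K = "\<lambda>x t. block22 (A x t)" and \<eta> = "\<lambda>j. \<xi> (Inr j)",
          OF exp_decaying_blocks(4) open_half(1) half_plus_rate])
  have 2: "matrix_holomorphic_on (kernel_transform (\<lambda>j. \<xi> (Inr j)) (\<lambda>x t. block12 (A x t))) half_plus"
    unfolding matrix_holomorphic_on_def
    by (intro allI holomorphic_kernel_transform[where K = "\<lambda>x t. block12 (A x t)" and \<eta> = "\<lambda>j. \<xi> (Inr j)",
          OF exp_decaying_blocks(2) open_half(1) half_plus_rate])
  show ?thesis
    unfolding jost_plus_def A_H_plus_def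
    by (intro matrix_holomorphic_on_add matrix_holomorphic_on_diff matrix_holomorphic_on_mult matrix_holomorphic_on_const 1 2)
qed

lemma holomorphic_jost_minus: "matrix_holomorphic_on jost_minus half_minus"
proof -
  have 1: "matrix_holomorphic_on (kernel_transform (\<lambda>j. \<xi> (Inl j)) (\<lambda>x t. block11 (A x t))) half_minus"
    unfolding matrix_holomorphic_on_def
    by (intro allI holomorphic_kernel_transform[where K = "\<lambda>x t. block11 (A x t)" and \<eta> = "\<lambda>j. \<xi> (Inl j)",
          OF exp_decaying_blocks(1) open_half(2) half_minus_rate])
  have 2: "matrix_holomorphic_on (kernel_transform (\<lambda>j. \<xi> (Inl j)) (\<lambda>x t. block21 (A x t))) half_minus"
    unfolding matrix_holomorphic_on_def
    by (intro allI holomorphic_kernel_transform[where K = "\<lambda>x t. block21 (A x t)" and \<eta> = "\<lambda>j. \<xi> (Inl j)",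
          OF exp_decaying_blocks(3) open_half(2) half_minus_rate])
  show ?thesis
    unfolding jost_minus_def A_H_minus_def
    by (intro matrix_holomorphic_on_add matrix_holomorphic_on_diff matrix_holomorphic_on_mult matrix_holomorphic_on_const 1 2)
qed

section \<open>Limits at infinity and isolated zeros of the determinants\<close>

lemma jost_plus_tendsto:
  assumes "\<delta> < width_plus"
  shows "(jost_plus \<longlongrightarrow> mat 1) (strip_at_infinity \<delta>)"
proof -
  have nz: "\<xi> (Inr j) \<noteq> 0" for j using pos[of j] by simp
  have \<delta>: "\<delta> * \<bar>\<xi> (Inr j)\<bar> < \<epsilon> * theta \<xi>" for j
    using below_width_plus[OF assms, of j] pos[of j] by simp
  have "(jost_plus \<longlongrightarrow> mat 1 + (0 - H ** 0)) (strip_at_infinity \<delta>)"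
    unfolding jost_plus_def A_H_plus_def
    by (intro tendsto_add tendsto_diff tendsto_matrix_mult tendsto_const
        kernel_transform_tendsto_0[where K = "\<lambda>x t. block22 (A x t)" and \<eta> = "\<lambda>j. \<xi> (Inr j)",
          OF exp_decaying_blocks(4) nz \<delta>]
        kernel_transform_tendsto_0[where K = "\<lambda>x t. block12 (A x t)" and \<eta> = "\<lambda>j. \<xi> (Inr j)",
          OF exp_decaying_blocks(2) nz \<delta>])
  then show ?thesis by simp
qed

lemma jost_minus_tendsto:
  assumes "\<delta> < width_minus"
  shows "(jost_minus \<longlongrightarrow> mat 1) (strip_at_infinity \<delta>)"
proof -
  have nz: "\<xi> (Inl j) \<noteq> 0" for j using neg[of j] by simp
  have \<delta>: "\<delta> * \<bar>\<xi> (Inl j)\<bar> < \<epsilon> * theta \<xi>" for j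
    using below_width_minus[OF assms, of j] neg[of j] by simp
  have "(jost_minus \<longlongrightarrow> mat 1 + (H ** 0 ** matrix_inv H - 0 ** matrix_inv H)) (strip_at_infinity \<delta>)"
    unfolding jost_minus_def A_H_minus_def
    by (intro tendsto_add tendsto_diff tendsto_matrix_mult tendsto_const
        kernel_transform_tendsto_0[where K = "\<lambda>x t. block11 (A x t)" and \<eta> = "\<lambda>j. \<xi> (Inl j)",
          OF exp_decaying_blocks(1) nz \<delta>]
        kernel_transform_tendsto_0[where K = "\<lambda>x t. block21 (A x t)" and \<eta> = "\<lambda>j. \<xi> (Inl j)",
          OF exp_decaying_blocks(3) nz \<delta>])
  then show ?thesis by simp
qed

lemma eventually_det_jost_nonzero_strip:
  assumes "\<delta> < width_plus" "\<delta> < width_minus"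
  shows "eventually (\<lambda>z. det (jost_plus z) \<noteq> 0 \<and> det (jost_minus z) \<noteq> 0) (strip_at_infinity \<delta>)"
proof (intro eventually_conj)
  have one: "det (mat 1 :: (complex, 'a) sqmat) \<noteq> 0" by simp
  show "eventually (\<lambda>z. det (jost_plus z) \<noteq> 0) (strip_at_infinity \<delta>)"
    by (rule tendsto_imp_eventually_ne[OF tendsto_det[OF tendsto_vec_nth_nth[OF jost_plus_tendsto[OF assms(1)]]] one])
  show "eventually (\<lambda>z. det (jost_minus z) \<noteq> 0) (strip_at_infinity \<delta>)"
    by (rule tendsto_imp_eventually_ne[OF tendsto_det[OF tendsto_vec_nth_nth[OF jost_minus_tendsto[OF assms(2)]]] one])
qed

text \<open>Both determinants tend to 1 along the real axis, the strip with \<delta> = 0. The point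
  found shows that neither vanishes identically, as the identity theorem requires.\<close>

lemma det_jost_nonzero_real:
  obtains \<beta> where "\<beta> \<in> half_plus" "\<beta> \<in> half_minus" "det (jost_plus \<beta>) \<noteq> 0" "det (jost_minus \<beta>) \<noteq> 0"
proof -
  have "eventually (\<lambda>z. z \<in> half_plus \<and> z \<in> half_minus) (strip_at_infinity 0)"
    using width_pos by (auto simp: eventually_inf_principal half_plus_def half_minus_def)
  then have "eventually (\<lambda>z. (z \<in> half_plus \<and> z \<in> half_minus) \<and> (det (jost_plus z) \<noteq> 0 \<and> det (jost_minus z) \<noteq> 0))
      (strip_at_infinity 0)"
    by (rule eventually_conj[OF _ eventually_det_jost_nonzero_strip[OF width_pos]])
  then show ?thesis
    using eventually_happens'[OF strip_at_infinity_neq_bot[OF order_refl]] that by blast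
qed

text \<open>The half-plane is connected and the determinant is not identically zero there, so its
  zeros are isolated.\<close>

lemma eventually_det_jost_plus_nonzero:
  assumes "z \<in> half_plus"
  shows "eventually (\<lambda>w. det (jost_plus w) \<noteq> 0) (at z)"
proof -
  obtain \<beta> where "\<beta> \<in> half_plus" "det (jost_plus \<beta>) \<noteq> 0" using det_jost_nonzero_real by blast
  then have "eventually (\<lambda>w. det (jost_plus w) \<noteq> 0 \<and> w \<in> half_plus) (at z)"
    using holomorphic_on_det[OF holomorphic_jost_plus] open_half convex_connected[OF convex_half(1)] assms
    by (intro non_zero_neighbour_alt) auto
  then show ?thesis by (rule eventually_mono) simp
qed

lemma eventually_det_jost_minus_nonzero:
  assumes "z \<in> half_minus"
  shows "eventually (\<lambda>w. det (jost_minus w) \<noteq> 0) (at z)"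
proof -
  obtain \<beta> where "\<beta> \<in> half_minus" "det (jost_minus \<beta>) \<noteq> 0" using det_jost_nonzero_real by blast
  then have "eventually (\<lambda>w. det (jost_minus w) \<noteq> 0 \<and> w \<in> half_minus) (at z)"
    using holomorphic_on_det[OF holomorphic_jost_minus] open_half convex_connected[OF convex_half(2)] assms
    by (intro non_zero_neighbour_alt) auto
  then show ?thesis by (rule eventually_mono) simp
qed

lemma det_scattering_nonzero:
  assumes "det (jost_plus z) \<noteq> 0" "det (jost_minus z) \<noteq> 0"
  shows "det (scattering_matrix \<xi> H A z) \<noteq> 0"
proof -
  have "det (jost_plus z) * det (matrix_inv (jost_plus z)) = 1"
    using matrix_inv_mult(1)[OF assms(1)] by (metis det_I det_mul)
  then have "det (matrix_inv (jost_plus z)) \<noteq> 0" by auto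
  then show ?thesis using assms by (simp add: scattering_matrix_eq det_mul)
qed

text \<open>The inverse is taken of the scattering matrix itself, whose determinant is nonzero
  wherever both factors are invertible, hence near every point of S except possibly the point
  itself.\<close>

lemma meromorphic_scattering:
  assumes "S \<subseteq> half_plus \<inter> half_minus"
  shows "matrix_meromorphic_on (scattering_matrix \<xi> H A) S"
    and "matrix_meromorphic_on (\<lambda>z. matrix_inv (scattering_matrix \<xi> H A z)) S"
proof -
  have "matrix_meromorphic_on jost_plus S" "matrix_meromorphic_on jost_minus S"
    using assms matrix_holomorphic_imp_meromorphic holomorphic_jost_plus holomorphic_jost_minus open_half
    by (blast intro: matrix_meromorphic_on_subset)+
  then have "matrix_meromorphic_on (\<lambda>z. matrix_inv (jost_plus z) ** jost_minus z) S"
    using assms eventually_det_jost_plus_nonzero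
    by (intro matrix_meromorphic_on_mult matrix_meromorphic_on_inv) auto
  then show S: "matrix_meromorphic_on (scattering_matrix \<xi> H A) S"
    by (simp add: scattering_matrix_eq[abs_def])
  show "matrix_meromorphic_on (\<lambda>z. matrix_inv (scattering_matrix \<xi> H A z)) S"
  proof (rule matrix_meromorphic_on_inv[OF S])
    fix z assume "z \<in> S"
    then have "eventually (\<lambda>w. det (jost_plus w) \<noteq> 0) (at z)" "eventually (\<lambda>w. det (jost_minus w) \<noteq> 0) (at z)"
      using assms eventually_det_jost_plus_nonzero eventually_det_jost_minus_nonzero by auto
    then show "eventually (\<lambda>w. det (scattering_matrix \<xi> H A w) \<noteq> 0) (at z)"
      by eventually_elim (rule det_scattering_nonzero)
  qed
qed

text \<open>The filter is left general for two uses: at a nonreal point, to exclude poles, and at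
  infinity in a strip.\<close>

lemma tendsto_scattering:
  assumes "(jost_plus \<longlongrightarrow> L) F" "(jost_minus \<longlongrightarrow> M) F" "det L \<noteq> 0" "det M \<noteq> 0"
  shows "(scattering_matrix \<xi> H A \<longlongrightarrow> matrix_inv L ** M) F"
    and "((\<lambda>z. matrix_inv (scattering_matrix \<xi> H A z)) \<longlongrightarrow> matrix_inv (matrix_inv L ** M)) F"
proof -
  show S: "(scattering_matrix \<xi> H A \<longlongrightarrow> matrix_inv L ** M) F"
    unfolding scattering_matrix_eq[abs_def]
    by (intro tendsto_matrix_mult tendsto_matrix_inv assms)
  have "det L * det (matrix_inv L) = 1"
    using matrix_inv_mult(1)[OF assms(3)] by (metis det_I det_mul)
  then have "det (matrix_inv L ** M) \<noteq> 0" using assms(4) by (auto simp: det_mul)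
  then show "((\<lambda>z. matrix_inv (scattering_matrix \<xi> H A z)) \<longlongrightarrow> matrix_inv (matrix_inv L ** M)) F"
    by (rule tendsto_matrix_inv[OF S])
qed

section \<open>Nonreal zeros, positivity of \<open>eps0\<close>, and conclusions in the
  strip\<close>

lemma nonreal_zeros_eq:
  "nonreal_zeros \<xi> \<epsilon> H A = {z. z \<notin> \<real> \<and> z \<in> half_plus \<and> det (jost_plus z) = 0} \<union>
     {z. z \<notin> \<real> \<and> z \<in> half_minus \<and> det (jost_minus z) = 0}"
  by (simp add: nonreal_zeros_def half_plus_def half_minus_def width_plus_def width_minus_def
      jost_plus_def jost_minus_def)

lemma eps0_eq: "eps0 \<xi> \<epsilon> H A = min (eps1 \<xi> \<epsilon> H A) (min (ereal width_minus) (ereal width_plus))"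
  by (simp add: eps0_def width_plus_def width_minus_def)

text \<open>Nonreal zeros could come arbitrarily close to the real axis only by accumulating at a
  real point or by escaping to infinity. Isolation of zeros forbids the former, the limit 1 of the
  determinants the latter.\<close>

lemma nonreal_zeros_away_from_reals:
  obtains d where "d > 0" "\<And>z. z \<in> nonreal_zeros \<xi> \<epsilon> H A \<Longrightarrow> d \<le> \<bar>Im z\<bar>"
proof -
  \<comment> \<open>Half of the smaller width, so that the closed strip lies inside both open
    half-planes.\<close>
  define \<delta> where "\<delta> = min width_plus width_minus / 2"
  have \<delta>: "\<delta> > 0" "\<delta> < width_plus" "\<delta> < width_minus"
    using width_pos by (auto simp: \<delta>_def min_def)
  define D where "D = (\<lambda>z. det (jost_plus z) * det (jost_minus z))"
  define U where "U = half_plus \<inter> half_minus"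
  have "D holomorphic_on U"
    unfolding D_def U_def
    by (intro holomorphic_on_mult holomorphic_on_subset[OF holomorphic_on_det[OF holomorphic_jost_plus]]
        holomorphic_on_subset[OF holomorphic_on_det[OF holomorphic_jost_minus]]) auto
  have U: "open U" "connected U"
    unfolding U_def using open_half convex_half by (auto intro: convex_connected convex_Int)
  obtain R where R: "\<And>z. norm z \<ge> R \<Longrightarrow> \<bar>Im z\<bar> \<le> \<delta> \<Longrightarrow> D z \<noteq> 0"
    using eventually_det_jost_nonzero_strip[OF \<delta>(2,3)]
    by (auto simp: eventually_inf_principal eventually_at_infinity D_def)
  define K where "K = cball 0 R \<inter> ({z. Im z \<le> \<delta>} \<inter> {z. Im z \<ge> - \<delta>})"
  have "compact K"
    unfolding K_def by (intro compact_Int_closed compact_cball closed_Int closed_halfspace_Im_le closed_halfspace_Im_ge)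
  have "K \<subseteq> U" using \<delta> by (auto simp: K_def U_def half_plus_def half_minus_def)
  obtain \<beta> where \<beta>: "\<beta> \<in> U" "D \<beta> \<noteq> 0"
    using det_jost_nonzero_real unfolding U_def D_def by (metis IntI mult_eq_0_iff)
  have fin: "finite {z \<in> K. D z = 0}"
  proof (cases "D constant_on U")
    case True
    then have "D z \<noteq> 0" if "z \<in> K" for z
      using \<beta> that \<open>K \<subseteq> U\<close> by (metis constant_on_def subsetD)
    then have "{z \<in> K. D z = 0} = {}" by blast
    then show ?thesis by (simp only: finite.emptyI)
  next
    case False
    then show ?thesis
      by (rule holomorphic_compact_finite_zeros[OF \<open>D holomorphic_on U\<close> U \<open>compact K\<close> \<open>K \<subseteq> U\<close>])
  qed
  define Z where "Z = {z \<in> K. D z = 0} - \<real>"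
  have "finite Z" using fin by (simp add: Z_def)
  \<comment> \<open>Inserting \<delta> covers the zeros outside the closed strip and keeps the
    minimum meaningful when Z is empty. Removing the real zeros from Z makes it positive.\<close>
  define d where "d = Min (insert \<delta> ((\<lambda>z. \<bar>Im z\<bar>) ` Z))"
  have "d > 0"
    unfolding d_def using \<open>finite Z\<close> \<delta>(1) by (subst Min_gr_iff) (auto simp: Z_def complex_is_Real_iff)
  moreover have "d \<le> \<bar>Im z\<bar>" if z: "z \<in> nonreal_zeros \<xi> \<epsilon> H A" for z
  proof (cases "\<bar>Im z\<bar> \<le> \<delta>")
    case True
    then have "D z = 0" using z by (auto simp: nonreal_zeros_eq D_def)
    moreover have "norm z < R" using R[of z] True \<open>D z = 0\<close> by force
    ultimately have "z \<in> Z" using z True by (auto simp: Z_def K_def nonreal_zeros_eq abs_le_iff)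
    then show ?thesis unfolding d_def using \<open>finite Z\<close> by (intro Min_le) auto
  next
    case False
    have "d \<le> \<delta>" unfolding d_def using \<open>finite Z\<close> by (intro Min_le) auto
    then show ?thesis using False by simp
  qed
  ultimately show ?thesis by (rule that)
qed

lemma eps0_pos: "eps0 \<xi> \<epsilon> H A > 0"
proof -
  obtain d where d: "d > 0" "\<And>z. z \<in> nonreal_zeros \<xi> \<epsilon> H A \<Longrightarrow> d \<le> \<bar>Im z\<bar>"
    using nonreal_zeros_away_from_reals by blast
  have "eps1 \<xi> \<epsilon> H A > 0"
  proof (cases "nonreal_zeros \<xi> \<epsilon> H A = {}")
    case False
    have "d \<le> setdist \<real> (nonreal_zeros \<xi> \<epsilon> H A)"
    proof (rule le_setdistI)
      fix x z :: complex assume x: "x \<in> \<real>" and z: "z \<in> nonreal_zeros \<xi> \<epsilon> H A"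
      have "\<bar>Im z\<bar> \<le> dist x z"
        using abs_Im_le_cmod[of "x - z"] x by (simp add: dist_norm complex_is_Real_iff)
      then show "d \<le> dist x z" using d(2)[OF z] by simp
    qed (use False in auto)
    then show ?thesis using d(1) False by (simp add: eps1_def)
  qed (simp add: eps1_def)
  then show ?thesis using width_pos by (simp add: eps0_eq)
qed

lemma nonreal_zeros_outside_strip:
  assumes "z \<in> nonreal_zeros \<xi> \<epsilon> H A"
  shows "eps0 \<xi> \<epsilon> H A \<le> ereal \<bar>Im z\<bar>"
proof -
  have "setdist \<real> (nonreal_zeros \<xi> \<epsilon> H A) \<le> dist (complex_of_real (Re z)) z"
    using assms by (intro setdist_le_dist) auto
  also have "\<dots> = \<bar>Im z\<bar>" by (simp add: dist_norm cmod_def)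
  finally show ?thesis using assms by (auto simp: eps0_eq eps1_def min_le_iff_disj)
qed

text \<open>Each ingredient of \<open>eps0\<close> has its use: the two widths keep z in both
  half-planes, and \<open>eps1\<close> keeps it away from the nonreal zeros.\<close>

lemma det_jost_nonzero:
  assumes "ereal \<bar>Im z\<bar> < eps0 \<xi> \<epsilon> H A" "z \<notin> \<real>"
  shows "z \<in> half_plus" "z \<in> half_minus" "det (jost_plus z) \<noteq> 0" "det (jost_minus z) \<noteq> 0"
proof -
  show half: "z \<in> half_plus" "z \<in> half_minus"
    using assms(1) by (auto simp: eps0_eq half_plus_def half_minus_def)
  have "z \<notin> nonreal_zeros \<xi> \<epsilon> H A" using nonreal_zeros_outside_strip[of z] assms(1) by auto
  then show "det (jost_plus z) \<noteq> 0" "det (jost_minus z) \<noteq> 0"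
    using half assms(2) by (auto simp: nonreal_zeros_eq)
qed

text \<open>Both factors are continuous and invertible at z, so the scattering matrix and its
  inverse have finite limits there.\<close>

lemma no_nonreal_poles:
  assumes "ereal \<bar>Im z\<bar> < eps0 \<xi> \<epsilon> H A" "z \<notin> \<real>"
  shows "\<not> matrix_pole (scattering_matrix \<xi> H A) z"
    and "\<not> matrix_pole (\<lambda>z. matrix_inv (scattering_matrix \<xi> H A z)) z"
proof -
  note nz = det_jost_nonzero[OF assms]
  note lim = matrix_holomorphic_on_tendsto[OF holomorphic_jost_plus open_half(1) nz(1)]
    matrix_holomorphic_on_tendsto[OF holomorphic_jost_minus open_half(2) nz(2)]
  show "\<not> matrix_pole (scattering_matrix \<xi> H A) z"
    and "\<not> matrix_pole (\<lambda>z. matrix_inv (scattering_matrix \<xi> H A z)) z"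
    by (rule tendsto_imp_not_matrix_pole[OF tendsto_scattering(1)[OF lim nz(3,4)]]
        tendsto_imp_not_matrix_pole[OF tendsto_scattering(2)[OF lim nz(3,4)]])+
qed

lemma scattering_tendsto_1:
  assumes "ereal \<delta> < eps0 \<xi> \<epsilon> H A"
  shows "(scattering_matrix \<xi> H A \<longlongrightarrow> mat 1) (strip_at_infinity \<delta>)"
    and "((\<lambda>z. matrix_inv (scattering_matrix \<xi> H A z)) \<longlongrightarrow> mat 1) (strip_at_infinity \<delta>)"
proof -
  have "\<delta> < width_plus" "\<delta> < width_minus" using assms by (auto simp: eps0_eq)
  note lim = jost_plus_tendsto[OF this(1)] jost_minus_tendsto[OF this(2)]
  have inv: "matrix_inv (mat 1 :: (complex, 'a) sqmat) = mat 1"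
    by (rule matrix_inv_unique_complex) simp
  show "(scattering_matrix \<xi> H A \<longlongrightarrow> mat 1) (strip_at_infinity \<delta>)"
    "((\<lambda>z. matrix_inv (scattering_matrix \<xi> H A z)) \<longlongrightarrow> mat 1) (strip_at_infinity \<delta>)"
    using tendsto_scattering[OF lim] by (simp_all add: inv)
qed

end

theorem theorem1:
  fixes \<xi> :: "'n::{finite,linorder} + 'n \<Rightarrow> real"
    and Q :: "real \<Rightarrow> (complex, 'n+'n) sqmat"
    and A :: "real \<Rightarrow> real \<Rightarrow> (complex, 'n+'n) sqmat"
    and H :: "(complex, 'n) sqmat"
    and C \<epsilon> :: real
  assumes "strict_mono (\<lambda>k. \<xi> (Inl k))" and "\<forall>k. \<xi> (Inl k) < 0"
    and "strict_mono (\<lambda>k. \<xi> (Inr k))" and "\<forall>k. 0 < \<xi> (Inr k)"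
    and "Q \<in> borel_measurable (lebesgue_on {0..})"
    and "M_canonical Q"
    and "C > 0" and "\<epsilon> > 0" and "\<forall>x\<ge>0. norm (Q x) \<le> C * exp (- \<epsilon> * x)"
    and "invertible H"
    and "transformation_kernels \<xi> Q A"
  shows "let S = scattering_matrix \<xi> H A;
             S_inv = (\<lambda>z. matrix_inv (S z));
             \<epsilon>\<^sub>0 = eps0 \<xi> \<epsilon> H A;
             strip = {z. ereal \<bar>Im z\<bar> < \<epsilon>\<^sub>0}
         in \<epsilon>\<^sub>0 > 0 \<and>
            matrix_meromorphic_on S strip \<and> matrix_meromorphic_on S_inv strip \<and>
            (\<forall>z\<in>strip. z \<notin> \<real> \<longrightarrow> \<not> matrix_pole S z \<and> \<not> matrix_pole S_inv z) \<and>
            (\<forall>\<delta>::real. ereal \<delta> < \<epsilon>\<^sub>0 \<longrightarrow>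
               (S \<longlongrightarrow> mat 1) (inf at_infinity (principal {z. \<bar>Im z\<bar> \<le> \<delta>})) \<and>
               (S_inv \<longlongrightarrow> mat 1) (inf at_infinity (principal {z. \<bar>Im z\<bar> \<le> \<delta>})))"
proof -
  interpret scattering \<xi> Q A C \<epsilon> H
    by unfold_locales (use assms in auto)
  have strip: "{z. ereal \<bar>Im z\<bar> < eps0 \<xi> \<epsilon> H A} \<subseteq> half_plus \<inter> half_minus"
    by (auto simp: eps0_eq half_plus_def half_minus_def)
  show ?thesis
    unfolding Let_def
    using eps0_pos meromorphic_scattering[OF strip] no_nonreal_poles scattering_tendsto_1 by auto
qed

end
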